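(* Let $P,Q\in\mathbb Z$, $Q\ne0$, $f(t)=t^2-Pt+Q$, $D=P^2-4Q\ne0$, and let $p$ be a prime with $p\nmid Q$. Let $G^*(f)$ be Laxton's group with subgroups $G^*(f,p)_L,K^*(f,p)_L,H^*(f,p)_L$, and let $G^*_{\mathbb Q}(f)$ with subgroups $G^*(f,p),K^*(f,p),H^*(f,p)$ be as in the context. Under the natural group isomorphism $\iota:G^*(f)\to G^*_{\mathbb Q}(f)$, $\mathcal W\mapsto\mathcal W$, we have $\iota(G^*(f,p)_L)=G^*(f,p)$, $\iota(K^*(f,p)_L)=K^*(f,p)$ and $\iota(H^*(f,p)_L)=H^*(f,p)$. Moreover there is an exact sequence of groups $$1\to G^*(f,p)\to K^*(f,p)\xrightarrow{\mathrm{red}_p}G^*_{\mathbb F_p}(f)\to1,$$ where $\mathrm{red}_p[w_1:w_0]=[w_1\bmod p:w_0\bmod p]$ for a representative with $w_0,w_1\in\mathbb Z$ coprime.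
   Context: For an integral domain $R$ with $Q\in R^\times$: $\mathscr S(f,R)^{\times}$ is the set of sequences $(w_n)_{n\in\mathbb Z}$ in $R$ with $w_{n+2}-Pw_{n+1}+Qw_n=0$ and $\Lambda(w_1,w_0):=w_1^2-Pw_0w_1+Qw_0^2\in R^{\times}$, a group under $(w_n)*(v_n)=(u_n)$, $u_1=w_1v_1-Qw_0v_0$, $u_0=w_0v_1+w_1v_0-Pw_0v_0$. $G_R(f)$ is its quotient by ${\bf w}\sim{\bf v}\iff w_n=\lambda v_n\ \forall n$ ($\lambda\in R^\times$), and $G^*_R(f)$ its quotient by ${\bf w}\sim^*{\bf v}\iff w_n=\lambda v_{n+\nu}\ \forall n$ ($\lambda\in R^\times,\nu\in\mathbb Z$); $[w_1:w_0]$ denotes the class of the sequence with initial terms $w_1,w_0$; $\pi:G_{\mathbb Q}(f)\to G^*_{\mathbb Q}(f)$ is the natural surjection. Laxton's group $G^*(f)$: the set of rational sequences $(w_n)$ satisfying the recurrence, with $\Lambda(w_1,w_0)\ne0$ and $w_k\in\mathbb Z$ for all $k\ge\nu$ for some $\nu$, modulo $\sim^*$ over $\mathbb Q$, with the same product. Say $p\mid{\bf w}$ if $w_n\in p\mathbb Z_{(p)}$ for some $n$. $G^*(f,p)_L=\{\mathcal W: p\mid{\bf w}\text{ for all }{\bf w}\in\mathcal W\}$; $K^*(f,p)_L=\{\mathcal W:\exists {\bf w}\in\mathcal W$ with $w_0,w_1\in\mathbb Z$, $p\nmid\Lambda(w_1,w_0)\}$; $H^*(f,p)_L=\{\mathcal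 W:\mathcal W^n\in G^*(f,p)_L$ for some nonzero $n\in\mathbb Z\}$. The reduction $\mathrm{red}_p:G_{\mathbb Q}(f)\to\mathbb P^1(\mathbb F_p)$ sends $[w_1:w_0]$, with $w_0,w_1\in\mathbb Z$ coprime, to $[w_1:w_0]\bmod p$; $G_{\mathbb F_p}(f)\subset\mathbb P^1(\mathbb F_p)$. Define $G(f,p)=\{x\in G_{\mathbb Q}(f):\mathrm{red}_p(x)=[1:0]\}$, $K(f,p)=\{x:\mathrm{red}_p(x)\in G_{\mathbb F_p}(f)\}$, $H(f,p)=\{x:\mathrm{red}_p(x^n)=[1:0]\text{ for some nonzero } n\in\mathbb Z\}$, and $G^*(f,p)=\pi(G(f,p))$, $K^*(f,p)=\pi(K(f,p))$, $H^*(f,p)=\pi(H(f,p))$. *)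

theory Defs
  imports "HOL-Algebra.Algebraic_Closure_Type" "HOL-Number_Theory.Residues"
begin

text \<open>
  Throughout, \<open>P\<close> and \<open>Q\<close> are elements of the domain \<open>R\<close>, \<open>Q\<close> a unit.
  For \<open>R = \<rat>\<close> and \<open>R = \<bbbF>\<^sub>p\<close> they are the images of two integers.
\<close>

definition rec_seqs :: "('a, 'b) ring_scheme \<Rightarrow> 'a \<Rightarrow> 'a \<Rightarrow> (int \<Rightarrow> 'a) set" where
  "rec_seqs R P Q = {w. (\<forall>n. w n \<in> carrier R) \<and>
     (\<forall>n. (w (n + 2) \<ominus>\<^bsub>R\<^esub> P \<otimes>\<^bsub>R\<^esub> w (n + 1)) \<oplus>\<^bsub>R\<^esub> Q \<otimes>\<^bsub>R\<^esub> w n = \<zero>\<^bsub>R\<^esub>)}"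

definition Lam :: "('a, 'b) ring_scheme \<Rightarrow> 'a \<Rightarrow> 'a \<Rightarrow> 'a \<Rightarrow> 'a \<Rightarrow> 'a" where
  "Lam R P Q w1 w0 =
     (w1 [^]\<^bsub>R\<^esub> (2::nat) \<ominus>\<^bsub>R\<^esub> P \<otimes>\<^bsub>R\<^esub> w0 \<otimes>\<^bsub>R\<^esub> w1) \<oplus>\<^bsub>R\<^esub> Q \<otimes>\<^bsub>R\<^esub> w0 [^]\<^bsub>R\<^esub> (2::nat)"

text \<open>As \<open>Q\<close> is a unit, a solution on all of \<open>\<int>\<close> is determined by its terms at 1 and 0.\<close>

definition init_seq :: "('a, 'b) ring_scheme \<Rightarrow> 'a \<Rightarrow> 'a \<Rightarrow> 'a \<Rightarrow> 'a \<Rightarrow> (int \<Rightarrow> 'a)" where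
  "init_seq R P Q w1 w0 = (THE w. w \<in> rec_seqs R P Q \<and> w 1 = w1 \<and> w 0 = w0)"

text \<open>The unit is the Lucas sequence, with initial terms \<open>w\<^sub>1 = 1\<close>, \<open>w\<^sub>0 = 0\<close>.\<close>

definition seq_group :: "('a, 'b) ring_scheme \<Rightarrow> 'a \<Rightarrow> 'a \<Rightarrow> (int \<Rightarrow> 'a) monoid" where
  "seq_group R P Q =
     \<lparr>carrier = {w \<in> rec_seqs R P Q. Lam R P Q (w 1) (w 0) \<in> Units R},
      monoid.mult = (\<lambda>w v. init_seq R P Q
        (w 1 \<otimes>\<^bsub>R\<^esub> v 1 \<ominus>\<^bsub>R\<^esub> Q \<otimes>\<^bsub>R\<^esub> w 0 \<otimes>\<^bsub>R\<^esub> v 0)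
        ((w 0 \<otimes>\<^bsub>R\<^esub> v 1 \<oplus>\<^bsub>R\<^esub> w 1 \<otimes>\<^bsub>R\<^esub> v 0) \<ominus>\<^bsub>R\<^esub> P \<otimes>\<^bsub>R\<^esub> w 0 \<otimes>\<^bsub>R\<^esub> v 0)),
      one = init_seq R P Q \<one>\<^bsub>R\<^esub> \<zero>\<^bsub>R\<^esub>\<rparr>"

definition scale_rel :: "('a, 'b) ring_scheme \<Rightarrow> (int \<Rightarrow> 'a) set \<Rightarrow> ((int \<Rightarrow> 'a) \<times> (int \<Rightarrow> 'a)) set" where
  "scale_rel R S = {(w, v). w \<in> S \<and> v \<in> S \<and>
     (\<exists>c \<in> Units R. \<forall>n. w n = c \<otimes>\<^bsub>R\<^esub> v n)}"

definition shift_rel :: "('a, 'b) ring_scheme \<Rightarrow> (int \<Rightarrow> 'a) set \<Rightarrow> ((int \<Rightarrow> 'a) \<times> (int \<Rightarrow> 'a)) set" where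
  "shift_rel R S = {(w, v). w \<in> S \<and> v \<in> S \<and>
     (\<exists>c \<in> Units R. \<exists>m::int. \<forall>n. w n = c \<otimes>\<^bsub>R\<^esub> v (n + m))}"

text \<open>Quotient of a monoid by a congruence; the product of two classes is the class of the
  products of their elements.\<close>

definition quot_monoid :: "('a, 'b) monoid_scheme \<Rightarrow> ('a \<times> 'a) set \<Rightarrow> 'a set monoid" where
  "quot_monoid M r =
     \<lparr>carrier = carrier M // r,
      monoid.mult = (\<lambda>A B. \<Union>a\<in>A. \<Union>b\<in>B. r `` {a \<otimes>\<^bsub>M\<^esub> b}),
      one = r `` {\<one>\<^bsub>M\<^esub>}\<rparr>"

definition G_grp :: "('a, 'b) ring_scheme \<Rightarrow> 'a \<Rightarrow> 'a \<Rightarrow> (int \<Rightarrow> 'a) set monoid" where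
  "G_grp R P Q = quot_monoid (seq_group R P Q) (scale_rel R (carrier (seq_group R P Q)))"

definition Gs_grp :: "('a, 'b) ring_scheme \<Rightarrow> 'a \<Rightarrow> 'a \<Rightarrow> (int \<Rightarrow> 'a) set monoid" where
  "Gs_grp R P Q = quot_monoid (seq_group R P Q) (shift_rel R (carrier (seq_group R P Q)))"

text \<open>The \<open>\<sim>\<^sup>*\<close>-class \<open>[w\<^sub>1 : w\<^sub>0]\<close>.\<close>

definition Gs_class :: "('a, 'b) ring_scheme \<Rightarrow> 'a \<Rightarrow> 'a \<Rightarrow> 'a \<Rightarrow> 'a \<Rightarrow> (int \<Rightarrow> 'a) set" where
  "Gs_class R P Q w1 w0 =
     shift_rel R (carrier (seq_group R P Q)) `` {init_seq R P Q w1 w0}"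

abbreviation rat_ring :: "rat ring" where
  "rat_ring \<equiv> ring_of_type_algebra"

abbreviation GQ :: "int \<Rightarrow> int \<Rightarrow> (int \<Rightarrow> rat) set monoid" where
  "GQ P Q \<equiv> G_grp rat_ring (of_int P) (of_int Q)"

abbreviation GsQ :: "int \<Rightarrow> int \<Rightarrow> (int \<Rightarrow> rat) set monoid" where
  "GsQ P Q \<equiv> Gs_grp rat_ring (of_int P) (of_int Q)"

abbreviation GF :: "int \<Rightarrow> int \<Rightarrow> nat \<Rightarrow> (int \<Rightarrow> int) set monoid" where
  "GF P Q p \<equiv> G_grp (residue_ring (int p)) (P mod int p) (Q mod int p)"

abbreviation GsF :: "int \<Rightarrow> int \<Rightarrow> nat \<Rightarrow> (int \<Rightarrow> int) set monoid" where
  "GsF P Q p \<equiv> Gs_grp (residue_ring (int p)) (P mod int p) (Q mod int p)"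

text \<open>A \<open>\<sim>\<close>-class, or a \<open>\<sim>\<^sup>*\<close>-class inside a smaller set of sequences, is sent to the
  \<open>\<sim>\<^sup>*\<close>-class over \<open>\<rat>\<close> that contains it. On \<open>GQ\<close> this is \<open>\<pi>\<close>, on Laxton's group it is \<open>\<iota>\<close>.\<close>

definition to_GsQ :: "int \<Rightarrow> int \<Rightarrow> (int \<Rightarrow> rat) set \<Rightarrow> (int \<Rightarrow> rat) set" where
  "to_GsQ P Q W =
     shift_rel rat_ring (carrier (seq_group rat_ring (of_int P) (of_int Q))) `` W"


subsection \<open>Laxton's group\<close>

definition laxton_seqs :: "int \<Rightarrow> int \<Rightarrow> (int \<Rightarrow> rat) set" where
  "laxton_seqs P Q = {w \<in> rec_seqs rat_ring (of_int P) (of_int Q).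
     Lam rat_ring (of_int P) (of_int Q) (w 1) (w 0) \<noteq> 0 \<and> (\<exists>m. \<forall>k\<ge>m. w k \<in> \<int>)}"

text \<open>The classes consist of eventually integral sequences only. This matters for
  \<open>laxton_G\<close>, which quantifies over all members of a class.\<close>

definition laxton_group :: "int \<Rightarrow> int \<Rightarrow> (int \<Rightarrow> rat) set monoid" where
  "laxton_group P Q =
     quot_monoid ((seq_group rat_ring (of_int P) (of_int Q))\<lparr>carrier := laxton_seqs P Q\<rparr>)
       (shift_rel rat_ring (laxton_seqs P Q))"

text \<open>The ideal \<open>p\<int>\<^sub>(\<^sub>p\<^sub>)\<close>, as a subset of \<open>\<rat>\<close>.\<close>

definition p_local_ideal :: "nat \<Rightarrow> rat set" where
  "p_local_ideal p = {of_int (int p * a) / of_int b | a b. \<not> int p dvd b}"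

definition seq_dvd :: "nat \<Rightarrow> (int \<Rightarrow> rat) \<Rightarrow> bool" where
  "seq_dvd p w \<longleftrightarrow> (\<exists>n. w n \<in> p_local_ideal p)"

definition laxton_G :: "int \<Rightarrow> int \<Rightarrow> nat \<Rightarrow> (int \<Rightarrow> rat) set set" where
  "laxton_G P Q p = {W \<in> carrier (laxton_group P Q). \<forall>w\<in>W. seq_dvd p w}"

definition laxton_K :: "int \<Rightarrow> int \<Rightarrow> nat \<Rightarrow> (int \<Rightarrow> rat) set set" where
  "laxton_K P Q p = {W \<in> carrier (laxton_group P Q).
     \<exists>w\<in>W. \<exists>a b::int. w 1 = of_int a \<and> w 0 = of_int b \<and>
       \<not> int p dvd (a^2 - P * b * a + Q * b^2)}"

definition laxton_H :: "int \<Rightarrow> int \<Rightarrow> nat \<Rightarrow> (int \<Rightarrow> rat) set set" where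
  "laxton_H P Q p = {W \<in> carrier (laxton_group P Q).
     \<exists>n::int. n \<noteq> 0 \<and> W [^]\<^bsub>laxton_group P Q\<^esub> n \<in> laxton_G P Q p}"


subsection \<open>Reduction modulo p\<close>

text \<open>The point \<open>[x : y]\<close> of the projective line over a field, as a class of pairs.\<close>

definition proj_pt :: "('a, 'b) ring_scheme \<Rightarrow> 'a \<Rightarrow> 'a \<Rightarrow> ('a \<times> 'a) set" where
  "proj_pt F x y = {(c \<otimes>\<^bsub>F\<^esub> x, c \<otimes>\<^bsub>F\<^esub> y) | c. c \<in> Units F}"

text \<open>The inclusion of \<open>G\<^sub>F(f)\<close> into the projective line.\<close>

definition to_proj :: "(int \<Rightarrow> 'a) set \<Rightarrow> ('a \<times> 'a) set" where
  "to_proj A = (\<lambda>w. (w 1, w 0)) ` A"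

definition coprime_init :: "(int \<Rightarrow> rat) \<Rightarrow> int \<Rightarrow> int \<Rightarrow> bool" where
  "coprime_init w a b \<longleftrightarrow> w 1 = of_int a \<and> w 0 = of_int b \<and> coprime a b"

definition red_proj :: "nat \<Rightarrow> (int \<Rightarrow> rat) set \<Rightarrow> (int \<times> int) set" where
  "red_proj p A = (THE c. \<exists>w\<in>A. \<exists>a b. coprime_init w a b \<and>
     c = proj_pt (residue_ring (int p)) (a mod int p) (b mod int p))"

definition G_p :: "int \<Rightarrow> int \<Rightarrow> nat \<Rightarrow> (int \<Rightarrow> rat) set set" where
  "G_p P Q p = {A \<in> carrier (GQ P Q). red_proj p A = proj_pt (residue_ring (int p)) 1 0}"

definition K_p :: "int \<Rightarrow> int \<Rightarrow> nat \<Rightarrow> (int \<Rightarrow> rat) set set" where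
  "K_p P Q p = {A \<in> carrier (GQ P Q). red_proj p A \<in> to_proj ` carrier (GF P Q p)}"

definition H_p :: "int \<Rightarrow> int \<Rightarrow> nat \<Rightarrow> (int \<Rightarrow> rat) set set" where
  "H_p P Q p = {A \<in> carrier (GQ P Q). \<exists>n::int. n \<noteq> 0 \<and>
     red_proj p (A [^]\<^bsub>GQ P Q\<^esub> n) = proj_pt (residue_ring (int p)) 1 0}"

definition Gs_p :: "int \<Rightarrow> int \<Rightarrow> nat \<Rightarrow> (int \<Rightarrow> rat) set set" where
  "Gs_p P Q p = to_GsQ P Q ` G_p P Q p"

definition Ks_p :: "int \<Rightarrow> int \<Rightarrow> nat \<Rightarrow> (int \<Rightarrow> rat) set set" where
  "Ks_p P Q p = to_GsQ P Q ` K_p P Q p"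

definition Hs_p :: "int \<Rightarrow> int \<Rightarrow> nat \<Rightarrow> (int \<Rightarrow> rat) set set" where
  "Hs_p P Q p = to_GsQ P Q ` H_p P Q p"

definition red_Gs :: "int \<Rightarrow> int \<Rightarrow> nat \<Rightarrow> (int \<Rightarrow> rat) set \<Rightarrow> (int \<Rightarrow> int) set" where
  "red_Gs P Q p W = (THE c. \<exists>w\<in>W. \<exists>a b. coprime_init w a b \<and>
     c = Gs_class (residue_ring (int p)) (P mod int p) (Q mod int p) (a mod int p) (b mod int p))"

text \<open>The library's \<open>exact_seq\<close> requires all groups to have the same element type.\<close>

definition short_exact ::
  "('a, 'd) monoid_scheme \<Rightarrow> ('a \<Rightarrow> 'b) \<Rightarrow> ('b, 'e) monoid_scheme \<Rightarrow> ('b \<Rightarrow> 'c) \<Rightarrow>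
   ('c, 'f) monoid_scheme \<Rightarrow> bool" where
  "short_exact A i B h C \<longleftrightarrow> group_hom A B i \<and> group_hom B C h \<and>
     inj_on i (carrier A) \<and> i ` carrier A = kernel B C h \<and> h ` carrier B = carrier C"

end

theory Submission
  imports Defs "HOL-Algebra.Bij"
begin

text \<open>
  Let \<open>\<theta>, \<theta>'\<close> be the roots of \<open>f\<close>. Attaching \<open>w\<^sub>1 - w\<^sub>0 \<theta>'\<close> to a sequence \<open>w\<close> turns the product
  of sequences into multiplication in \<open>R[\<theta>]\<close>, \<open>\<Lambda>\<close> into the norm and the shift into multiplication by
  \<open>\<theta>\<close>; hence both equivalence relations are congruences. Now let \<open>A\<close> be a local subring of \<open>K\<close> with
  residue field \<open>F\<close>, where \<open>Q\<close> is a unit of \<open>A\<close>. A sequence over \<open>A\<close> whose reduction vanishes at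
  two consecutive places has zero reduction, so two sequences that are primitive (nonzero modulo
  the maximal ideal) and equivalent over \<open>K\<close> differ by a shift and a unit of \<open>A\<close>, and have
  equivalent reductions. With \<open>A = \<int>\<^sub>(\<^sub>p\<^sub>)\<close>, all subgroups of the theorem are therefore images of the
  group \<open>\<S>(f, A)\<^sup>\<times>\<close>, of its subgroup given by \<open>p | w\<^sub>0\<close>, and of the elements some power of which lies
  in that subgroup up to scaling. The kernel of \<open>\<pi>\<close> consists of the classes of the shifts of the
  Lucas sequence, whose reductions lie in a finite group; this is why taking roots of elements
  commutes with \<open>\<pi>\<close>.
\<close>

section \<open>Quotients of monoids by congruences\<close>

locale monoid_congruence = monoid M for M (structure) +
  fixes r :: "('a \<times> 'a) set"
  assumes equiv_rel: "equiv (carrier M) r"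
    and rel_mult: "(a, a') \<in> r \<Longrightarrow> (b, b') \<in> r \<Longrightarrow> (a \<otimes> b, a' \<otimes> b') \<in> r"
begin

lemma class_eq_iff:
  "a \<in> carrier M \<Longrightarrow> b \<in> carrier M \<Longrightarrow> r `` {a} = r `` {b} \<longleftrightarrow> (a, b) \<in> r"
  by (rule eq_equiv_class_iff[OF equiv_rel])

lemma carrier_quot_monoid: "carrier (quot_monoid M r) = (\<lambda>a. r `` {a}) ` carrier M"
  by (auto simp: quot_monoid_def quotient_def)

lemma one_quot_monoid: "\<one>\<^bsub>quot_monoid M r\<^esub> = r `` {\<one>}"
  by (simp add: quot_monoid_def)

lemma mult_quot_monoid:
  assumes "a \<in> carrier M" "b \<in> carrier M"
  shows "r `` {a} \<otimes>\<^bsub>quot_monoid M r\<^esub> r `` {b} = r `` {a \<otimes> b}"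
proof -
  have "r `` {a' \<otimes> b'} = r `` {a \<otimes> b}" if "a' \<in> r `` {a}" "b' \<in> r `` {b}" for a' b'
    using that by (intro equiv_class_eq[OF equiv_rel, symmetric] rel_mult) simp_all
  moreover have "a \<in> r `` {a}" "b \<in> r `` {b}"
    using equiv_class_self[OF equiv_rel] assms by blast+
  ultimately have "(\<Union>a'\<in>r `` {a}. \<Union>b'\<in>r `` {b}. r `` {a' \<otimes> b'}) = r `` {a \<otimes> b}"
    by blast
  then show ?thesis
    by (simp add: quot_monoid_def)
qed

lemma class_hom: "(\<lambda>a. r `` {a}) \<in> hom M (quot_monoid M r)"
  by (auto simp: hom_def carrier_quot_monoid mult_quot_monoid)

lemma quot_monoid_eq_image:
  "quot_monoid M r = (quot_monoid M r)
    \<lparr>carrier := (\<lambda>a. r `` {a}) ` carrier M, one := r `` {\<one>}\<rparr>"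
  unfolding carrier_quot_monoid[symmetric] one_quot_monoid[symmetric] by simp

lemma monoid_quot_monoid: "monoid (quot_monoid M r)"
  using hom_imp_img_monoid[OF class_hom] by (subst quot_monoid_eq_image)

lemma comm_group_quot_monoid: "comm_group M \<Longrightarrow> comm_group (quot_monoid M r)"
  using comm_group.hom_imp_img_comm_group[OF _ class_hom] by (subst quot_monoid_eq_image)

end

text \<open>Instances are \<open>\<pi>\<close>, where \<open>L\<close> is everything and \<open>s\<close> is finer than \<open>r\<close>, and \<open>\<iota>\<close>, where \<open>s\<close> is
  the restriction of \<open>r\<close> to \<open>L\<close>.\<close>

locale subcongruence =
  big: monoid_congruence M r + small: monoid_congruence "M\<lparr>carrier := L\<rparr>" s
  for M (structure) and r L s +
  assumes submonoid: "submonoid L M" and rel_subset: "s \<subseteq> r"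
begin

lemma carrier_subset: "L \<subseteq> carrier M"
  by (rule submonoid.subset[OF submonoid])

lemma Image_class:
  assumes "a \<in> L"
  shows "r `` (s `` {a}) = r `` {a}"
proof -
  have "a \<in> s `` {a}"
    using equiv_class_self[OF small.equiv_rel] assms by simp
  moreover have "r `` {b} = r `` {a}" if "b \<in> s `` {a}" for b
    using that rel_subset equiv_class_eq[OF big.equiv_rel] by blast
  ultimately have "(\<Union>b\<in>s `` {a}. r `` {b}) = r `` {a}"
    by blast
  then show ?thesis
    by (simp only: Image_eq_UN[of r "s `` {a}"])
qed

lemma Image_hom: "(``) r \<in> hom (quot_monoid (M\<lparr>carrier := L\<rparr>) s) (quot_monoid M r)"
proof (rule homI)
  fix A B
  assume "A \<in> carrier (quot_monoid (M\<lparr>carrier := L\<rparr>) s)"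
    "B \<in> carrier (quot_monoid (M\<lparr>carrier := L\<rparr>) s)"
  then obtain a b where ab: "a \<in> L" "b \<in> L" "A = s `` {a}" "B = s `` {b}"
    by (auto simp: small.carrier_quot_monoid)
  then have mem: "a \<in> carrier M" "b \<in> carrier M" "a \<otimes> b \<in> L"
    using carrier_subset submonoid.m_closed[OF submonoid] by auto
  with ab show "r `` A \<in> carrier (quot_monoid M r)"
    by (auto simp: Image_class big.carrier_quot_monoid)
  have "A \<otimes>\<^bsub>quot_monoid (M\<lparr>carrier := L\<rparr>) s\<^esub> B = s `` {a \<otimes> b}"
    using ab small.mult_quot_monoid[of a b] by simp
  with ab mem show "r `` (A \<otimes>\<^bsub>quot_monoid (M\<lparr>carrier := L\<rparr>) s\<^esub> B) =
      r `` A \<otimes>\<^bsub>quot_monoid M r\<^esub> r `` B"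
    by (simp add: Image_class big.mult_quot_monoid)
qed

lemma Image_surj:
  assumes "\<And>a. a \<in> carrier M \<Longrightarrow> \<exists>b\<in>L. (a, b) \<in> r"
  shows "(``) r ` carrier (quot_monoid (M\<lparr>carrier := L\<rparr>) s) = carrier (quot_monoid M r)"
proof -
  have "(``) r ` carrier (quot_monoid (M\<lparr>carrier := L\<rparr>) s) = (\<lambda>a. r `` {a}) ` L"
    by (simp add: small.carrier_quot_monoid image_image Image_class)
  also have "\<dots> = (\<lambda>a. r `` {a}) ` carrier M"
  proof (rule equalityI[OF image_mono[OF carrier_subset]], intro image_subsetI)
    fix a assume "a \<in> carrier M"
    then obtain b where "b \<in> L" "(a, b) \<in> r"
      using assms by blast
    then show "r `` {a} \<in> (\<lambda>a. r `` {a}) ` L"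
      using equiv_class_eq[OF big.equiv_rel] by (intro image_eqI)
  qed
  finally show ?thesis
    by (simp only: big.carrier_quot_monoid)
qed

lemma Image_iso:
  assumes "Restr r L \<subseteq> s" and "\<And>a. a \<in> carrier M \<Longrightarrow> \<exists>b\<in>L. (a, b) \<in> r"
  shows "(``) r \<in> iso (quot_monoid (M\<lparr>carrier := L\<rparr>) s) (quot_monoid M r)"
proof (rule isoI[OF Image_hom bij_betw_imageI[OF _ Image_surj[OF assms(2)]]])
  have "inj_on (\<lambda>A. r `` A) ((\<lambda>a. s `` {a}) ` L)"
  proof (intro inj_onI, elim imageE, hypsubst)
    fix a b assume ab: "a \<in> L" "b \<in> L" "r `` (s `` {a}) = r `` (s `` {b})"
    then have "r `` {a} = r `` {b}"
      by (simp only: Image_class)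
    then have "(a, b) \<in> r"
      using ab carrier_subset big.class_eq_iff by blast
    then have "(a, b) \<in> s"
      using ab assms(1) by blast
    then show "s `` {a} = s `` {b}"
      by (rule equiv_class_eq[OF small.equiv_rel])
  qed
  then show "inj_on ((``) r) (carrier (quot_monoid (M\<lparr>carrier := L\<rparr>) s))"
    by (simp add: small.carrier_quot_monoid)
qed

end

section \<open>Isolators\<close>

definition isolator :: "('a, 'b) monoid_scheme \<Rightarrow> 'a set \<Rightarrow> 'a set" where
  "isolator G H = {x \<in> carrier G. \<exists>n::int. n \<noteq> 0 \<and> x [^]\<^bsub>G\<^esub> n \<in> H}"

lemma isolatorI: "x \<in> carrier G \<Longrightarrow> n \<noteq> 0 \<Longrightarrow> x [^]\<^bsub>G\<^esub> (n::int) \<in> H \<Longrightarrow> x \<in> isolator G H"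
  by (auto simp: isolator_def)

lemma isolatorE:
  assumes "x \<in> isolator G H"
  obtains n :: int where "x \<in> carrier G" "n \<noteq> 0" "x [^]\<^bsub>G\<^esub> n \<in> H"
  using assms by (auto simp: isolator_def)

lemma isolator_subset: "isolator G H \<subseteq> carrier G"
  by (auto simp: isolator_def)

lemma (in group) subset_isolator: "H \<subseteq> carrier G \<Longrightarrow> H \<subseteq> isolator G H"
  by (auto simp: int_pow_1 intro!: isolatorI[where n = 1])

lemma (in comm_group) isolator_subgroup:
  assumes H: "subgroup H G"
  shows "subgroup (isolator G H) G"
proof (rule subgroupI[OF isolator_subset])
  show "isolator G H \<noteq> {}"
    using subset_isolator[OF subgroup.subset[OF H]] subgroup.one_closed[OF H] by blast
  show "inv x \<in> isolator G H" if "x \<in> isolator G H" for x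
    using that H by (auto simp: isolator_def int_pow_inv subgroup.m_inv_closed)
  show "x \<otimes> y \<in> isolator G H" if "x \<in> isolator G H" "y \<in> isolator G H" for x y
  proof -
    obtain n m :: int where x: "x \<in> carrier G" "n \<noteq> 0" "x [^] n \<in> H"
      and y: "y \<in> carrier G" "m \<noteq> 0" "y [^] m \<in> H"
      using \<open>x \<in> isolator G H\<close> \<open>y \<in> isolator G H\<close> by (meson isolatorE)
    have "(x \<otimes> y) [^] (n * m) = (x [^] n) [^] m \<otimes> (y [^] m) [^] n"
      using x(1) y(1) by (simp add: int_pow_mult_distrib m_comm int_pow_pow mult.commute)
    also have "\<dots> \<in> H"
      using subgroup.m_closed[OF H subgroup_int_pow_closed[OF H x(3)]
          subgroup_int_pow_closed[OF H y(3)]] .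
    finally show ?thesis
      using x y by (intro isolatorI[where n = "n * m"]) auto
  qed
qed

lemma (in group) isolator_isolator: "isolator G (isolator G H) \<subseteq> isolator G H"
proof
  fix x assume "x \<in> isolator G (isolator G H)"
  then obtain n m :: int where "x \<in> carrier G" "n \<noteq> 0" "m \<noteq> 0" "(x [^] n) [^] m \<in> H"
    by (meson isolatorE)
  then show "x \<in> isolator G H"
    by (intro isolatorI[where n = "n * m"]) (simp_all add: int_pow_pow)
qed

lemma (in group_hom) image_isolator_subset: "h ` isolator G A \<subseteq> isolator H (h ` A)"
proof (intro image_subsetI)
  fix x assume "x \<in> isolator G A"
  then obtain n :: int where n: "x \<in> carrier G" "n \<noteq> 0" "x [^] n \<in> A"
    by (rule isolatorE)
  then have "h x [^]\<^bsub>H\<^esub> n \<in> h ` A"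
    by (metis hom_int_pow image_eqI)
  with n show "h x \<in> isolator H (h ` A)"
    by (intro isolatorI) simp_all
qed

lemma (in group_hom) isolator_image:
  assumes G: "comm_group G" and surj: "h ` carrier G = carrier H"
    and A: "subgroup A G" and ker: "kernel G H h \<subseteq> isolator G A"
  shows "h ` isolator G A = isolator H (h ` A)"
proof (intro equalityI image_isolator_subset subsetI)
  interpret isolator: subgroup "isolator G A" G
    by (rule comm_group.isolator_subgroup[OF G A])
  fix y assume "y \<in> isolator H (h ` A)"
  then obtain n :: int and a where n: "y \<in> carrier H" "n \<noteq> 0" "a \<in> A" "y [^]\<^bsub>H\<^esub> n = h a"
    by (auto simp: isolator_def)
  obtain x where x: "x \<in> carrier G" "y = h x"
    using n(1) surj by blast
  have a: "a \<in> carrier G" "a \<in> isolator G A"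
    using n(3) subgroup.subset[OF A] G.subset_isolator[OF subgroup.subset[OF A]] by blast+
  have "h (x [^] n \<otimes> inv a) = \<one>\<^bsub>H\<^esub>"
    using n(4) x a(1) by (simp add: hom_int_pow)
  then have "x [^] n \<otimes> inv a \<in> isolator G A"
    using x(1) a(1) ker by (auto simp: kernel_def)
  then have "x [^] n \<otimes> inv a \<otimes> a \<in> isolator G A"
    using a(2) by (rule isolator.m_closed)
  then have "x [^] n \<in> isolator G A"
    using x(1) a(1) by (simp add: G.m_assoc)
  then have "x \<in> isolator G A"
    using isolatorI[OF x(1) n(2)] G.isolator_isolator by blast
  then show "y \<in> h ` isolator G A"
    using x(2) by blast
qed

lemma (in group_hom) isolator_kernel:
  assumes "finite (carrier H)"
  shows "isolator G (kernel G H h) = carrier G"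
proof (intro equalityI isolator_subset subsetI)
  fix x assume x: "x \<in> carrier G"
  then have "h (x [^] Coset.order H) = \<one>\<^bsub>H\<^esub>"
    by (simp add: hom_nat_pow H.pow_order_eq_1)
  with x show "x \<in> isolator G (kernel G H h)"
    using assms H.order_gt_0_iff_finite
    by (intro isolatorI[where n = "int (Coset.order H)"]) (simp_all add: kernel_def int_pow_int)
qed

lemma subgroup_iso_vimage:
  assumes "group G" "group H" "h \<in> iso G H" "A \<subseteq> carrier G" "subgroup (h ` A) H"
  shows "subgroup A G"
proof -
  let ?g = "inv_into (carrier G) h"
  have "?g \<in> hom H G"
    using group.iso_set_sym[OF assms(1,3)] by (simp add: iso_def)
  then interpret group_hom H G ?g
    using assms by (simp add: group_hom_def group_hom_axioms_def)
  have "?g ` h ` A = A"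
    using assms by (intro inv_into_image_cancel) (auto simp: iso_def bij_betw_def)
  then show ?thesis
    using subgroup_img_is_subgroup[OF assms(5)] by simp
qed

lemma comm_group_iso_vimage:
  assumes "monoid G" "comm_group H" "h \<in> iso G H"
  shows "comm_group G"
proof -
  interpret G: monoid G by fact
  interpret H: comm_group H by fact
  have hom: "h x \<in> carrier H" "h (x \<otimes>\<^bsub>G\<^esub> y) = h x \<otimes>\<^bsub>H\<^esub> h y"
    if "x \<in> carrier G" "y \<in> carrier G" for x y
    using assms(3) that by (auto simp: iso_def hom_def)
  have inj: "x = y" if "h x = h y" "x \<in> carrier G" "y \<in> carrier G" for x y
    using assms(3) that by (auto simp: iso_def bij_betw_def inj_on_def)
  have "h \<one>\<^bsub>G\<^esub> \<otimes>\<^bsub>H\<^esub> h \<one>\<^bsub>G\<^esub> = h \<one>\<^bsub>G\<^esub>"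
    using hom(2)[of "\<one>\<^bsub>G\<^esub>" "\<one>\<^bsub>G\<^esub>"] by simp
  then have one: "h \<one>\<^bsub>G\<^esub> = \<one>\<^bsub>H\<^esub>"
    by (simp only: H.l_cancel_one hom(1)[OF G.one_closed G.one_closed])
  show ?thesis
  proof (rule comm_groupI)
    fix x assume x: "x \<in> carrier G"
    then have "inv\<^bsub>H\<^esub> h x \<in> h ` carrier G"
      using assms(3) hom(1) by (simp add: iso_def bij_betw_def)
    then obtain y where y: "y \<in> carrier G" "h y = inv\<^bsub>H\<^esub> h x"
      by auto
    then have "h (y \<otimes>\<^bsub>G\<^esub> x) = h \<one>\<^bsub>G\<^esub>"
      using x hom one by simp
    then show "\<exists>y\<in>carrier G. y \<otimes>\<^bsub>G\<^esub> x = \<one>\<^bsub>G\<^esub>"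
      using x y(1) by (intro bexI[of _ y] inj) simp_all
  next
    fix x y assume "x \<in> carrier G" "y \<in> carrier G"
    then show "x \<otimes>\<^bsub>G\<^esub> y = y \<otimes>\<^bsub>G\<^esub> x"
      using hom by (intro inj) (simp_all add: H.m_comm)
  qed (simp_all add: G.m_assoc)
qed

section \<open>The group of sequences over a commutative ring\<close>

lemma (in cring) Lam_eq:
  "x \<in> carrier R \<Longrightarrow> y \<in> carrier R \<Longrightarrow>
    Lam R P Q x y = x \<otimes> x \<ominus> P \<otimes> y \<otimes> x \<oplus> Q \<otimes> (y \<otimes> y)"
  by (simp add: Lam_def numeral_2_eq_2)

lemma (in comm_monoid) Units_mult_iff:
  "x \<in> Units G \<Longrightarrow> y \<in> carrier G \<Longrightarrow> x \<otimes> y \<in> Units G \<longleftrightarrow> y \<in> Units G"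
  by (metis Units_m_closed m_comm Units_closed unit_factor)

lemma (in cring) proj_pt_scale:
  assumes c: "c \<in> Units R" and xy: "x \<in> carrier R" "y \<in> carrier R"
  shows "proj_pt R (c \<otimes> x) (c \<otimes> y) = proj_pt R x y"
proof (intro equalityI subsetI)
  fix z assume "z \<in> proj_pt R (c \<otimes> x) (c \<otimes> y)"
  then obtain d where d: "d \<in> Units R" "z = (d \<otimes> (c \<otimes> x), d \<otimes> (c \<otimes> y))"
    by (auto simp: proj_pt_def)
  then have "z = ((d \<otimes> c) \<otimes> x, (d \<otimes> c) \<otimes> y)"
    using c xy by (simp add: m_assoc Units_closed)
  then show "z \<in> proj_pt R x y"
    using Units_m_closed[OF d(1) c] unfolding proj_pt_def by blast
next
  fix z assume "z \<in> proj_pt R x y"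
  then obtain d where d: "d \<in> Units R" "z = (d \<otimes> x, d \<otimes> y)"
    by (auto simp: proj_pt_def)
  have "(d \<otimes> inv c) \<otimes> (c \<otimes> u) = d \<otimes> u" if "u \<in> carrier R" for u
    using that c d(1) by (simp add: m_assoc Units_closed flip: m_assoc[of "inv c" c u])
  then have "z = ((d \<otimes> inv c) \<otimes> (c \<otimes> x), (d \<otimes> inv c) \<otimes> (c \<otimes> y))"
    using d(2) xy by simp
  then show "z \<in> proj_pt R (c \<otimes> x) (c \<otimes> y)"
    using Units_m_closed[OF d(1) Units_inv_Units[OF c]] unfolding proj_pt_def by blast
qed

locale recurrence = cring R for R (structure) +
  fixes P Q
  assumes P_closed [simp]: "P \<in> carrier R" and Q_unit [simp]: "Q \<in> Units R"
begin

abbreviation "seqs \<equiv> rec_seqs R P Q"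
abbreviation "SG \<equiv> seq_group R P Q"
abbreviation "\<Lambda> \<equiv> Lam R P Q"

lemma Q_closed [simp]: "Q \<in> carrier R"
  by (rule Units_closed[OF Q_unit])

lemma rec_seqs_iff:
  "w \<in> seqs \<longleftrightarrow> (\<forall>n. w n \<in> carrier R) \<and> (\<forall>n. w (n + 2) = P \<otimes> w (n + 1) \<ominus> Q \<otimes> w n)"
proof -
  have "a \<ominus> b \<oplus> c = \<zero> \<longleftrightarrow> a = b \<ominus> c"
    if "a \<in> carrier R" "b \<in> carrier R" "c \<in> carrier R" for a b c
  proof -
    have "a \<ominus> b \<oplus> c = a \<ominus> (b \<ominus> c)"
      using that by algebra
    then show ?thesis
      using that by (simp only: r_right_minus_eq minus_closed)
  qed
  then have "w (n + 2) \<ominus> P \<otimes> w (n + 1) \<oplus> Q \<otimes> w n = \<zero> \<longleftrightarrow>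
      w (n + 2) = P \<otimes> w (n + 1) \<ominus> Q \<otimes> w n" if "\<forall>n. w n \<in> carrier R" for n
    using that by simp
  then show ?thesis
    unfolding rec_seqs_def mem_Collect_eq by blast
qed

lemma rec_seqsI:
  assumes "\<And>n. w n \<in> carrier R" "\<And>n. w (n + 2) = P \<otimes> w (n + 1) \<ominus> Q \<otimes> w n"
  shows "w \<in> seqs"
  using assms by (simp add: rec_seqs_iff)

lemma rec_closed [simp]: "w \<in> seqs \<Longrightarrow> w n \<in> carrier R"
  by (simp add: rec_seqs_iff)

lemma rec_step: "w \<in> seqs \<Longrightarrow> w (n + 2) = P \<otimes> w (n + 1) \<ominus> Q \<otimes> w n"
  by (simp add: rec_seqs_iff)

lemma rec_step_back: "w \<in> seqs \<Longrightarrow> Q \<otimes> w n = P \<otimes> w (n + 1) \<ominus> w (n + 2)"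
  using rec_closed[of w "n + 1"] rec_closed[of w n] P_closed Q_closed
  by (simp only: rec_step) algebra

lemma rec_seqs_eqI:
  assumes w: "w \<in> seqs" and v: "v \<in> seqs" and init: "w 1 = v 1" "w 0 = v 0"
  shows "w = v"
proof
  fix n
  have "w n = v n \<and> w (n + 1) = v (n + 1)"
  proof (induction n rule: int_induct[where k = 0])
    case base
    then show ?case using init by simp
  next
    case (step1 i)
    then show ?case
      using rec_step[OF w, of i] rec_step[OF v, of i] by (simp add: add.assoc)
  next
    case (step2 i)
    then have "Q \<otimes> w (i - 1) = Q \<otimes> v (i - 1)"
      using rec_step_back[OF w, of "i - 1"] rec_step_back[OF v, of "i - 1"]
      by (simp add: add.commute[of 1])
    then show ?case
      using step2 w v Units_l_cancel[OF Q_unit, of "w (i - 1)" "v (i - 1)"] by simp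
  qed
  then show "w n = v n" ..
qed

lemma rec_seqs_shift: "w \<in> seqs \<Longrightarrow> (\<lambda>n. w (n + m)) \<in> seqs"
  using rec_step[of w "n + m" for n] by (intro rec_seqsI) (simp_all add: algebra_simps)

lemma rec_seqs_lincomb:
  assumes "w \<in> seqs" "v \<in> seqs" "a \<in> carrier R" "b \<in> carrier R"
  shows "(\<lambda>n. a \<otimes> w n \<oplus> b \<otimes> v n) \<in> seqs"
proof -
  have "a \<otimes> w (n + 2) \<oplus> b \<otimes> v (n + 2) =
      P \<otimes> (a \<otimes> w (n + 1) \<oplus> b \<otimes> v (n + 1)) \<ominus> Q \<otimes> (a \<otimes> w n \<oplus> b \<otimes> v n)" for n
    unfolding rec_step[OF assms(1)] rec_step[OF assms(2)]
    using assms(3,4) P_closed Q_closed rec_closed[OF assms(1)] rec_closed[OF assms(2)]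
    by algebra
  then show ?thesis
    using assms by (intro rec_seqsI) simp_all
qed

lemma rec_seqs_scale: "w \<in> seqs \<Longrightarrow> c \<in> carrier R \<Longrightarrow> (\<lambda>n. c \<otimes> w n) \<in> seqs"
  using rec_seqs_lincomb[of w w c \<zero>] by simp

lemma rec_seqs_scale_shift: "w \<in> seqs \<Longrightarrow> c \<in> carrier R \<Longrightarrow> (\<lambda>n. c \<otimes> w (n + m)) \<in> seqs"
  by (rule rec_seqs_scale[OF rec_seqs_shift])

lemma rec_seqs_zero: "(\<lambda>n. \<zero>) \<in> seqs"
  by (rule rec_seqsI) (simp_all add: a_minus_def)

lemma bij_betw_companion:
  "bij_betw (\<lambda>(a, b). (P \<otimes> a \<ominus> Q \<otimes> b, a)) (carrier R \<times> carrier R) (carrier R \<times> carrier R)"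
proof -
  have "inv Q \<otimes> (Q \<otimes> z) = z" "Q \<otimes> (inv Q \<otimes> z) = z" if "z \<in> carrier R" for z
    using that by (simp_all add: m_assoc[symmetric])
  moreover have "a \<ominus> (a \<ominus> b) = b" if "a \<in> carrier R" "b \<in> carrier R" for a b
    using that by algebra
  ultimately show ?thesis
    by (intro bij_betwI[where g = "\<lambda>(a, b). (b, inv Q \<otimes> (P \<otimes> b \<ominus> a))"]) auto
qed

lemma rec_seqs_exist:
  assumes "x \<in> carrier R" "y \<in> carrier R"
  obtains w where "w \<in> seqs" "w 1 = x" "w 0 = y"
proof -
  let ?A = "carrier R \<times> carrier R"
  let ?B = "BijGroup ?A"
  interpret B: group ?B
    by (rule group_BijGroup)
  define T where "T = (\<lambda>(a, b) \<in> ?A. (P \<otimes> a \<ominus> Q \<otimes> b, a))"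
  define f where "f n = (T [^]\<^bsub>?B\<^esub> n) (x, y)" for n :: int
  have carrier_B: "carrier ?B = Bij ?A"
    by (simp add: BijGroup_def)
  have mult_B: "(g \<otimes>\<^bsub>?B\<^esub> h) z = g (h z)"
      if "g \<in> Bij ?A" "h \<in> Bij ?A" "z \<in> ?A" for g h z
    using that by (simp_all add: BijGroup_def compose_def)
  have T: "T \<in> carrier ?B"
    unfolding carrier_B T_def using bij_betw_companion by (simp add: Bij_def)
  have T_pow: "T [^]\<^bsub>?B\<^esub> n \<in> Bij ?A" for n :: int
    using B.int_pow_closed[OF T] by (simp only: carrier_B)
  have f_closed: "f n \<in> ?A" for n
    unfolding f_def by (rule funcset_mem[OF Bij_imp_funcset[OF T_pow]]) (use assms in simp)
  have "T [^]\<^bsub>?B\<^esub> (n + 1) = T \<otimes>\<^bsub>?B\<^esub> T [^]\<^bsub>?B\<^esub> n" for n :: int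
    using B.int_pow_mult[OF T, of 1 n] by (simp only: add.commute[of n] B.int_pow_1[OF T])
  then have "f (n + 1) = T (f n)" for n
    unfolding f_def using T T_pow[of n] assms
    by (simp only: carrier_B mult_B mem_Times_iff fst_conv snd_conv)
  then have f_step: "f (n + 1) = (P \<otimes> fst (f n) \<ominus> Q \<otimes> snd (f n), fst (f n))" for n
    using f_closed[of n] by (auto simp: T_def)
  have "snd (f (n + 2)) = P \<otimes> snd (f (n + 1)) \<ominus> Q \<otimes> snd (f n)" for n
    using f_step[of "n + 1"] f_step[of n] by (simp add: add.assoc)
  moreover have "snd (f n) \<in> carrier R" for n
    using f_closed[of n] by auto
  moreover have "f 0 = (x, y)"
    using assms by (simp add: f_def BijGroup_def)
  ultimately show ?thesis
    using f_step[of 0] by (intro that[of "\<lambda>n. snd (f n)"] rec_seqsI) simp_all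
qed

lemma init_seq_eqI: "w \<in> seqs \<Longrightarrow> w 1 = x \<Longrightarrow> w 0 = y \<Longrightarrow> init_seq R P Q x y = w"
  unfolding init_seq_def using rec_seqs_eqI by (intro the_equality) auto

lemma init_seq [simp]:
  assumes "x \<in> carrier R" "y \<in> carrier R"
  shows "init_seq R P Q x y \<in> seqs" "init_seq R P Q x y 1 = x" "init_seq R P Q x y 0 = y"
  using rec_seqs_exist[OF assms] init_seq_eqI by metis+

lemma carrier_seq_group: "w \<in> carrier SG \<longleftrightarrow> w \<in> seqs \<and> \<Lambda> (w 1) (w 0) \<in> Units R"
  by (simp add: seq_group_def)

lemma carrier_seqs: "w \<in> carrier SG \<Longrightarrow> w \<in> seqs"
  by (simp add: carrier_seq_group)

lemma mult_closed [simp]: "w \<in> seqs \<Longrightarrow> v \<in> seqs \<Longrightarrow> w \<otimes>\<^bsub>SG\<^esub> v \<in> seqs"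
  by (simp add: seq_group_def)

lemma mult_1: "w \<in> seqs \<Longrightarrow> v \<in> seqs \<Longrightarrow> (w \<otimes>\<^bsub>SG\<^esub> v) 1 = w 1 \<otimes> v 1 \<ominus> Q \<otimes> w 0 \<otimes> v 0"
  by (simp add: seq_group_def)

lemma mult_0: "w \<in> seqs \<Longrightarrow> v \<in> seqs \<Longrightarrow>
    (w \<otimes>\<^bsub>SG\<^esub> v) 0 = (w 0 \<otimes> v 1 \<oplus> w 1 \<otimes> v 0) \<ominus> P \<otimes> w 0 \<otimes> v 0"
  by (simp add: seq_group_def)

lemma one_seq [simp]: "\<one>\<^bsub>SG\<^esub> \<in> seqs" "\<one>\<^bsub>SG\<^esub> 1 = \<one>" "\<one>\<^bsub>SG\<^esub> 0 = \<zero>"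
  by (simp_all add: seq_group_def)

lemma mult_comm: "w \<in> seqs \<Longrightarrow> v \<in> seqs \<Longrightarrow> w \<otimes>\<^bsub>SG\<^esub> v = v \<otimes>\<^bsub>SG\<^esub> w"
  by (rule rec_seqs_eqI) (simp_all add: mult_1 mult_0 m_ac a_ac)

lemma mult_one: "w \<in> seqs \<Longrightarrow> \<one>\<^bsub>SG\<^esub> \<otimes>\<^bsub>SG\<^esub> w = w"
  by (rule rec_seqs_eqI) (simp_all add: mult_1 mult_0 a_minus_def)

lemma mult_eq_lincomb:
  assumes w: "w \<in> seqs" and v: "v \<in> seqs"
  shows "w \<otimes>\<^bsub>SG\<^esub> v = (\<lambda>n. v 1 \<otimes> w n \<oplus> \<ominus> (Q \<otimes> v 0) \<otimes> w (n + - 1))"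
proof (rule rec_seqs_eqI)
  note closed = rec_closed[OF w] rec_closed[OF v] P_closed Q_closed
  show "w \<otimes>\<^bsub>SG\<^esub> v \<in> seqs"
    using assms by simp
  show "(\<lambda>n. v 1 \<otimes> w n \<oplus> \<ominus> (Q \<otimes> v 0) \<otimes> w (n + - 1)) \<in> seqs"
    using w v by (intro rec_seqs_lincomb rec_seqs_shift) auto
  show "(w \<otimes>\<^bsub>SG\<^esub> v) 1 = v 1 \<otimes> w 1 \<oplus> \<ominus> (Q \<otimes> v 0) \<otimes> w (1 + - 1)"
    unfolding mult_1[OF assms] add.right_inverse using closed by algebra
  have "\<ominus> (Q \<otimes> v 0) \<otimes> w (- 1) = \<ominus> (Q \<otimes> w (- 1)) \<otimes> v 0"
    using closed by algebra
  also have "Q \<otimes> w (- 1) = P \<otimes> w 0 \<ominus> w 1"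
    using rec_step_back[OF w, of "- 1"] by simp
  finally show "(w \<otimes>\<^bsub>SG\<^esub> v) 0 = v 1 \<otimes> w 0 \<oplus> \<ominus> (Q \<otimes> v 0) \<otimes> w (0 + - 1)"
    unfolding mult_0[OF assms] add_0 using closed by (simp only:) algebra
qed

lemma mult_right_comm:
  assumes w: "w \<in> seqs" and u: "u \<in> seqs" and v: "v \<in> seqs"
  shows "w \<otimes>\<^bsub>SG\<^esub> u \<otimes>\<^bsub>SG\<^esub> v = w \<otimes>\<^bsub>SG\<^esub> v \<otimes>\<^bsub>SG\<^esub> u"
proof -
  have "c \<otimes> (a \<otimes> x \<oplus> b \<otimes> y) \<oplus> d \<otimes> (a \<otimes> y \<oplus> b \<otimes> z) = a \<otimes> (c \<otimes> x \<oplus> d \<otimes> y) \<oplus> b \<otimes> (c \<otimes> y \<oplus> d \<otimes> z)"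
    if "a \<in> carrier R" "b \<in> carrier R" "c \<in> carrier R" "d \<in> carrier R"
      "x \<in> carrier R" "y \<in> carrier R" "z \<in> carrier R" for a b c d x y z
    using that by algebra
  then show ?thesis
    unfolding mult_eq_lincomb[OF mult_closed[OF w u] v] mult_eq_lincomb[OF mult_closed[OF w v] u]
    using w u v by (simp add: mult_eq_lincomb)
qed

lemma mult_assoc:
  assumes "u \<in> seqs" "w \<in> seqs" "v \<in> seqs"
  shows "u \<otimes>\<^bsub>SG\<^esub> w \<otimes>\<^bsub>SG\<^esub> v = u \<otimes>\<^bsub>SG\<^esub> (w \<otimes>\<^bsub>SG\<^esub> v)"
  using mult_right_comm[OF assms(2,1,3)] mult_comm[OF assms(1,2)]
    mult_comm[OF assms(1) mult_closed[OF assms(2,3)]] by (simp only:)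

lemma Lam_closed [simp]: "x \<in> carrier R \<Longrightarrow> y \<in> carrier R \<Longrightarrow> \<Lambda> x y \<in> carrier R"
  by (simp add: Lam_def)

lemma Lam_one: "\<Lambda> \<one> \<zero> = \<one>"
  by (simp add: Lam_eq a_minus_def)

lemma Lam_mult:
  assumes w: "w \<in> seqs" and v: "v \<in> seqs"
  shows "\<Lambda> ((w \<otimes>\<^bsub>SG\<^esub> v) 1) ((w \<otimes>\<^bsub>SG\<^esub> v) 0) = \<Lambda> (w 1) (w 0) \<otimes> \<Lambda> (v 1) (v 0)"
proof -
  define a b c d where "a = w 1" and "b = w 0" and "c = v 1" and "d = v 0"
  define a' c' where "a' = a \<ominus> P \<otimes> b" and "c' = c \<ominus> P \<otimes> d"
  have closed: "a \<in> carrier R" "b \<in> carrier R" "c \<in> carrier R" "d \<in> carrier R"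
    using w v by (simp_all add: a_def b_def c_def d_def)
  have closed': "a' \<in> carrier R" "c' \<in> carrier R"
    using closed by (simp_all add: a'_def c'_def)
  have \<Lambda>_conj: "\<Lambda> x y = x \<otimes> (x \<ominus> P \<otimes> y) \<oplus> Q \<otimes> (y \<otimes> y)"
    if "x \<in> carrier R" "y \<in> carrier R" for x y
    unfolding Lam_eq[OF that] using that P_closed Q_closed by algebra
  define x y where "x = a \<otimes> c \<ominus> Q \<otimes> b \<otimes> d" and "y = (b \<otimes> c \<oplus> a \<otimes> d) \<ominus> P \<otimes> b \<otimes> d"
  have x_conj: "x \<ominus> P \<otimes> y = a' \<otimes> c' \<ominus> Q \<otimes> b \<otimes> d"
    unfolding x_def y_def a'_def c'_def using closed P_closed Q_closed by algebra
  have y_eq: "y = b \<otimes> c' \<oplus> a \<otimes> d" "y = b \<otimes> c \<oplus> a' \<otimes> d"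
    unfolding y_def a'_def c'_def using closed P_closed by algebra+
  have "\<Lambda> x y = x \<otimes> (x \<ominus> P \<otimes> y) \<oplus> Q \<otimes> (y \<otimes> y)"
    using closed by (intro \<Lambda>_conj) (simp_all add: x_def y_def)
  also have "\<dots> = (a \<otimes> c \<ominus> Q \<otimes> b \<otimes> d) \<otimes> (a' \<otimes> c' \<ominus> Q \<otimes> b \<otimes> d) \<oplus>
      Q \<otimes> ((b \<otimes> c' \<oplus> a \<otimes> d) \<otimes> (b \<otimes> c \<oplus> a' \<otimes> d))"
    by (simp only: x_conj flip: x_def y_eq)
  also have "\<dots> = (a \<otimes> a' \<oplus> Q \<otimes> (b \<otimes> b)) \<otimes> (c \<otimes> c' \<oplus> Q \<otimes> (d \<otimes> d))"
    using closed closed' Q_closed by algebra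
  also have "\<dots> = \<Lambda> a b \<otimes> \<Lambda> c d"
    using closed by (simp only: \<Lambda>_conj a'_def c'_def)
  finally show ?thesis
    using mult_1[OF w v] mult_0[OF w v] by (simp add: x_def y_def a_def b_def c_def d_def)
qed

lemma mult_scale_shift_left:
  assumes w: "w \<in> seqs" and v: "v \<in> seqs" and c: "c \<in> carrier R"
  shows "(\<lambda>n. c \<otimes> w (n + m)) \<otimes>\<^bsub>SG\<^esub> v = (\<lambda>n. c \<otimes> (w \<otimes>\<^bsub>SG\<^esub> v) (n + m))"
proof -
  have "v 1 \<otimes> (c \<otimes> w (n + m)) \<oplus> \<ominus> (Q \<otimes> v 0) \<otimes> (c \<otimes> w (n + - 1 + m)) =
      c \<otimes> (v 1 \<otimes> w (n + m) \<oplus> \<ominus> (Q \<otimes> v 0) \<otimes> w (n + m + - 1))" for n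
    using rec_closed[OF w] rec_closed[OF v] c Q_closed
    by (simp only: add.assoc add.commute[of m]) algebra
  then show ?thesis
    unfolding mult_eq_lincomb[OF rec_seqs_scale_shift[OF w c] v] mult_eq_lincomb[OF w v]
    by (rule ext)
qed

lemma mult_scale_shift:
  assumes "w \<in> seqs" "v \<in> seqs" "c \<in> carrier R" "d \<in> carrier R"
  shows "(\<lambda>n. c \<otimes> w (n + m)) \<otimes>\<^bsub>SG\<^esub> (\<lambda>n. d \<otimes> v (n + k)) =
    (\<lambda>n. (c \<otimes> d) \<otimes> (w \<otimes>\<^bsub>SG\<^esub> v) (n + (m + k)))"
proof -
  let ?v = "\<lambda>n. d \<otimes> v (n + k)"
  have v': "?v \<in> seqs"
    using assms by (intro rec_seqs_scale_shift)
  have "w \<otimes>\<^bsub>SG\<^esub> ?v = (\<lambda>n. d \<otimes> (w \<otimes>\<^bsub>SG\<^esub> v) (n + k))"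
    using assms v' by (simp only: mult_comm[of w] mult_scale_shift_left)
  then have "(\<lambda>n. c \<otimes> w (n + m)) \<otimes>\<^bsub>SG\<^esub> ?v = (\<lambda>n. c \<otimes> (d \<otimes> (w \<otimes>\<^bsub>SG\<^esub> v) (n + m + k)))"
    by (simp only: mult_scale_shift_left[OF assms(1) v' assms(3)])
  then show ?thesis
    using assms by (simp add: m_assoc add.assoc)
qed

lemma mult_shift:
  assumes "w \<in> seqs" "v \<in> seqs"
  shows "(\<lambda>n. w (n + m)) \<otimes>\<^bsub>SG\<^esub> (\<lambda>n. v (n + k)) = (\<lambda>n. (w \<otimes>\<^bsub>SG\<^esub> v) (n + (m + k)))"
  using mult_scale_shift[OF assms one_closed one_closed, of m k] assms by simp

lemma Lam_scale:
  assumes "c \<in> carrier R" "x \<in> carrier R" "y \<in> carrier R"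
  shows "\<Lambda> (c \<otimes> x) (c \<otimes> y) = c \<otimes> c \<otimes> \<Lambda> x y"
  using assms P_closed Q_closed by (simp only: Lam_eq m_closed) algebra

lemma Lam_step:
  assumes w: "w \<in> seqs"
  shows "\<Lambda> (w (n + 2)) (w (n + 1)) = Q \<otimes> \<Lambda> (w (n + 1)) (w n)"
  using rec_closed[OF w] P_closed Q_closed
  by (simp only: rec_step[OF w] Lam_eq minus_closed m_closed) algebra

lemma Lam_unit_shift:
  assumes w: "w \<in> seqs"
  shows "\<Lambda> (w (n + 1)) (w n) \<in> Units R \<longleftrightarrow> \<Lambda> (w 1) (w 0) \<in> Units R"
proof (induction n rule: int_induct[where k = 0])
  case base
  then show ?case by simp
next
  case (step1 i)
  then show ?case
    using Lam_step[OF w, of i] w by (simp add: Units_mult_iff add.assoc)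
next
  case (step2 i)
  then show ?case
    using Lam_step[OF w, of "i - 1"] w by (simp add: Units_mult_iff algebra_simps)
qed

lemma carrier_scale_shift:
  assumes w: "w \<in> carrier SG" and c: "c \<in> Units R"
  shows "(\<lambda>n. c \<otimes> w (n + m)) \<in> carrier SG"
  using w c Lam_unit_shift[of w m]
  by (simp add: carrier_seq_group rec_seqs_scale_shift Units_closed Lam_scale Units_mult_iff
      add.commute)

lemma left_inverse_exists:
  assumes w: "w \<in> carrier SG"
  shows "\<exists>y\<in>carrier SG. y \<otimes>\<^bsub>SG\<^esub> w = \<one>\<^bsub>SG\<^esub>"
proof -
  let ?N = "\<Lambda> (w 1) (w 0)"
  define w_conj where "w_conj = init_seq R P Q (w 1 \<ominus> P \<otimes> w 0) (\<ominus> w 0)"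
  define y where "y n = inv ?N \<otimes> w_conj (n + 0)" for n
  have w_seqs: "w \<in> seqs" and N: "?N \<in> Units R"
    using w by (auto simp: carrier_seq_group)
  note closed = rec_closed[OF w_seqs] P_closed Q_closed
  have w_conj: "w_conj \<in> seqs" "w_conj 1 = w 1 \<ominus> P \<otimes> w 0" "w_conj 0 = \<ominus> w 0"
    using w_seqs by (simp_all add: w_conj_def)
  have y: "y \<in> seqs"
    unfolding y_def using w_conj(1) N by (intro rec_seqs_scale_shift) simp_all
  have "(w_conj \<otimes>\<^bsub>SG\<^esub> w) 1 = ?N"
    unfolding mult_1[OF w_conj(1) w_seqs] w_conj Lam_eq[OF closed(1) closed(1)] using closed
    by algebra
  moreover have "(w_conj \<otimes>\<^bsub>SG\<^esub> w) 0 = \<zero>"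
    unfolding mult_0[OF w_conj(1) w_seqs] w_conj using closed by algebra
  moreover have "y \<otimes>\<^bsub>SG\<^esub> w = (\<lambda>n. inv ?N \<otimes> (w_conj \<otimes>\<^bsub>SG\<^esub> w) (n + 0))"
    unfolding y_def using w_conj(1) w_seqs N by (intro mult_scale_shift_left) simp_all
  ultimately have yw: "y \<otimes>\<^bsub>SG\<^esub> w = \<one>\<^bsub>SG\<^esub>"
    using N by (intro rec_seqs_eqI mult_closed y w_seqs one_seq(1)) simp_all
  have "?N \<otimes> \<Lambda> (y 1) (y 0) = \<one>"
    using Lam_mult[OF y w_seqs] y w_seqs by (simp add: yw Lam_one m_comm)
  then have "\<Lambda> (y 1) (y 0) \<in> Units R"
    using y Units_mult_iff[OF N, of "\<Lambda> (y 1) (y 0)"] by simp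
  then have "y \<in> carrier SG"
    using y by (simp add: carrier_seq_group)
  with yw show ?thesis ..
qed

sublocale SG: comm_group SG
proof (rule comm_groupI)
  show "\<one>\<^bsub>SG\<^esub> \<in> carrier SG"
    by (simp add: carrier_seq_group Lam_one)
  show "w \<otimes>\<^bsub>SG\<^esub> v = v \<otimes>\<^bsub>SG\<^esub> w" if "w \<in> carrier SG" "v \<in> carrier SG" for w v
    using that by (simp add: carrier_seq_group mult_comm)
qed (use left_inverse_exists in \<open>simp_all add: carrier_seq_group Lam_mult mult_assoc mult_one\<close>)

lemma finite_seq_group:
  assumes "finite (carrier R)"
  shows "finite (carrier SG)"
proof (rule inj_on_finite[of "\<lambda>w. (w 1, w 0)"])
  show "inj_on (\<lambda>w. (w 1, w 0)) (carrier SG)"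
    using carrier_seqs by (auto intro!: inj_onI rec_seqs_eqI)
  show "(\<lambda>w. (w 1, w 0)) ` carrier SG \<subseteq> carrier R \<times> carrier R"
    using carrier_seqs by auto
qed (use assms in simp)

end

subsection \<open>Scaling and shifting\<close>

definition scale_shift_rel ::
  "('a, 'b) ring_scheme \<Rightarrow> int set \<Rightarrow> (int \<Rightarrow> 'a) set \<Rightarrow> ((int \<Rightarrow> 'a) \<times> (int \<Rightarrow> 'a)) set" where
  "scale_shift_rel R M S = {(w, v). w \<in> S \<and> v \<in> S \<and>
     (\<exists>c\<in>Units R. \<exists>m\<in>M. w = (\<lambda>n. c \<otimes>\<^bsub>R\<^esub> v (n + m)))}"

lemma scale_shift_relI:
  "w \<in> S \<Longrightarrow> v \<in> S \<Longrightarrow> c \<in> Units R \<Longrightarrow> m \<in> M \<Longrightarrow> w = (\<lambda>n. c \<otimes>\<^bsub>R\<^esub> v (n + m)) \<Longrightarrow>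
    (w, v) \<in> scale_shift_rel R M S"
  unfolding scale_shift_rel_def by blast

lemma scale_shift_relE:
  assumes "(w, v) \<in> scale_shift_rel R M S"
  obtains c m where "w \<in> S" "v \<in> S" "c \<in> Units R" "m \<in> M" "w = (\<lambda>n. c \<otimes>\<^bsub>R\<^esub> v (n + m))"
  using assms unfolding scale_shift_rel_def by blast

lemma scale_rel_eq: "scale_rel R S = scale_shift_rel R {0} S"
  by (simp add: scale_rel_def scale_shift_rel_def fun_eq_iff)

lemma shift_rel_eq: "shift_rel R S = scale_shift_rel R UNIV S"
  by (simp add: shift_rel_def scale_shift_rel_def fun_eq_iff)

context recurrence
begin

lemma equiv_scale_shift_rel:
  assumes M: "subgroup M integer_group" and S: "S \<subseteq> seqs"
  shows "equiv S (scale_shift_rel R M S)"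
proof (intro equivI refl_onI symI transI)
  show "scale_shift_rel R M S \<subseteq> S \<times> S"
    by (auto simp: scale_shift_rel_def)
  show "(w, w) \<in> scale_shift_rel R M S" if "w \<in> S" for w
    using that S subgroup.one_closed[OF M]
    by (intro scale_shift_relI[where c = \<one> and m = 0]) auto
  show "(v, w) \<in> scale_shift_rel R M S" if "(w, v) \<in> scale_shift_rel R M S" for w v
    using that
  proof (rule scale_shift_relE)
    fix c m assume w: "w \<in> S" "v \<in> S" "c \<in> Units R" "m \<in> M" "w = (\<lambda>n. c \<otimes> v (n + m))"
    then have "v = (\<lambda>n. inv c \<otimes> w (n + inv\<^bsub>integer_group\<^esub> m))"
      using S by (auto simp: m_assoc[symmetric] Units_closed)
    then show ?thesis
      by (rule scale_shift_relI[OF w(2,1) Units_inv_Units[OF w(3)]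
            subgroup.m_inv_closed[OF M w(4)]])
  qed
  show "(u, v) \<in> scale_shift_rel R M S"
    if "(u, w) \<in> scale_shift_rel R M S" "(w, v) \<in> scale_shift_rel R M S" for u w v
    using that
  proof (elim scale_shift_relE)
    fix c m d k
    assume u: "u \<in> S" "c \<in> Units R" "m \<in> M" "u = (\<lambda>n. c \<otimes> w (n + m))"
      and v: "v \<in> S" "d \<in> Units R" "k \<in> M" "w = (\<lambda>n. d \<otimes> v (n + k))"
    then have "u = (\<lambda>n. (c \<otimes> d) \<otimes> v (n + m \<otimes>\<^bsub>integer_group\<^esub> k))"
      using S by (auto simp: m_assoc Units_closed add.assoc)
    then show ?thesis
      by (rule scale_shift_relI[OF u(1) v(1) Units_m_closed[OF u(2) v(2)]
            subgroup.m_closed[OF M u(3) v(3)]])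
  qed
qed

lemma scale_shift_congruence:
  assumes M: "subgroup M integer_group" and S: "submonoid S SG"
  shows "monoid_congruence (SG\<lparr>carrier := S\<rparr>) (scale_shift_rel R M S)"
proof (rule monoid_congruence.intro[OF submonoid.submonoid_is_monoid[OF S SG.monoid_axioms]],
    unfold_locales)
  have S_seqs: "S \<subseteq> seqs"
    using submonoid.subset[OF S] carrier_seqs by blast
  then show "equiv (carrier (SG\<lparr>carrier := S\<rparr>)) (scale_shift_rel R M S)"
    using equiv_scale_shift_rel[OF M] by simp
  fix w w' v v'
  assume "(w, w') \<in> scale_shift_rel R M S" "(v, v') \<in> scale_shift_rel R M S"
  then show "(w \<otimes>\<^bsub>SG\<lparr>carrier := S\<rparr>\<^esub> v, w' \<otimes>\<^bsub>SG\<lparr>carrier := S\<rparr>\<^esub> v') \<in> scale_shift_rel R M S"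
  proof (elim scale_shift_relE)
    fix c m d k
    assume w: "w \<in> S" "w' \<in> S" "c \<in> Units R" "m \<in> M" "w = (\<lambda>n. c \<otimes> w' (n + m))"
      and v: "v \<in> S" "v' \<in> S" "d \<in> Units R" "k \<in> M" "v = (\<lambda>n. d \<otimes> v' (n + k))"
    have "w \<otimes>\<^bsub>SG\<^esub> v = (\<lambda>n. (c \<otimes> d) \<otimes> (w' \<otimes>\<^bsub>SG\<^esub> v') (n + m \<otimes>\<^bsub>integer_group\<^esub> k))"
      unfolding w(5) v(5) mult_integer_group
      using w v S_seqs by (intro mult_scale_shift Units_closed) auto
    then have "(w \<otimes>\<^bsub>SG\<^esub> v, w' \<otimes>\<^bsub>SG\<^esub> v') \<in> scale_shift_rel R M S"
      by (rule scale_shift_relI[OF submonoid.m_closed[OF S w(1) v(1)]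
            submonoid.m_closed[OF S w(2) v(2)] Units_m_closed[OF w(3) v(3)]
            subgroup.m_closed[OF M w(4) v(4)]])
    then show ?thesis
      by simp
  qed
qed

lemma submonoid_carrier: "submonoid (carrier SG) SG"
  by unfold_locales auto

sublocale scale: monoid_congruence SG "scale_rel R (carrier SG)"
  using scale_shift_congruence[OF group.triv_subgroup[OF group_integer_group] submonoid_carrier]
  by (simp add: scale_rel_eq)

sublocale shift: monoid_congruence SG "shift_rel R (carrier SG)"
  using scale_shift_congruence[OF group.subgroup_self[OF group_integer_group] submonoid_carrier]
  by (simp add: shift_rel_eq)

definition scale_class :: "(int \<Rightarrow> 'a) \<Rightarrow> (int \<Rightarrow> 'a) set" where
  "scale_class w = scale_rel R (carrier SG) `` {w}"

definition shift_class :: "(int \<Rightarrow> 'a) \<Rightarrow> (int \<Rightarrow> 'a) set" where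
  "shift_class w = shift_rel R (carrier SG) `` {w}"

lemma scale_class_eq_iff:
  "w \<in> carrier SG \<Longrightarrow> v \<in> carrier SG \<Longrightarrow>
    scale_class w = scale_class v \<longleftrightarrow> (\<exists>c\<in>Units R. w = (\<lambda>n. c \<otimes> v n))"
  by (simp add: scale_class_def scale.class_eq_iff) (simp add: scale_rel_def fun_eq_iff)

lemma shift_class_eq_iff:
  "w \<in> carrier SG \<Longrightarrow> v \<in> carrier SG \<Longrightarrow>
    shift_class w = shift_class v \<longleftrightarrow> (\<exists>c\<in>Units R. \<exists>m. w = (\<lambda>n. c \<otimes> v (n + m)))"
  by (simp add: shift_class_def shift.class_eq_iff) (simp add: shift_rel_def fun_eq_iff)

lemma mem_scale_class_iff:
  "w \<in> carrier SG \<Longrightarrow> v \<in> scale_class w \<longleftrightarrow> v \<in> carrier SG \<and> scale_class v = scale_class w"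
  using equiv_class_eq_iff[OF scale.equiv_rel, of w v] by (auto simp: scale_class_def)

lemma mem_shift_class_iff:
  "w \<in> carrier SG \<Longrightarrow> v \<in> shift_class w \<longleftrightarrow> v \<in> carrier SG \<and> shift_class v = shift_class w"
  using equiv_class_eq_iff[OF shift.equiv_rel, of w v] by (auto simp: shift_class_def)

sublocale G: comm_group "G_grp R P Q"
  unfolding G_grp_def by (rule scale.comm_group_quot_monoid[OF SG.comm_group_axioms])

sublocale Gs: comm_group "Gs_grp R P Q"
  unfolding Gs_grp_def by (rule shift.comm_group_quot_monoid[OF SG.comm_group_axioms])

sublocale scale_class: group_hom SG "G_grp R P Q" scale_class
  unfolding scale_class_def[abs_def] G_grp_def
  by (intro group_hom.intro group_hom_axioms.intro scale.class_hom SG.group_axioms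
      G.group_axioms[unfolded G_grp_def])

sublocale shift_class: group_hom SG "Gs_grp R P Q" shift_class
  unfolding shift_class_def[abs_def] Gs_grp_def
  by (intro group_hom.intro group_hom_axioms.intro shift.class_hom SG.group_axioms
      Gs.group_axioms[unfolded Gs_grp_def])

lemma carrier_G_grp: "carrier (G_grp R P Q) = scale_class ` carrier SG"
  unfolding G_grp_def scale_class_def[abs_def] by (rule scale.carrier_quot_monoid)

lemma carrier_Gs_grp: "carrier (Gs_grp R P Q) = shift_class ` carrier SG"
  unfolding Gs_grp_def shift_class_def[abs_def] by (rule shift.carrier_quot_monoid)

lemma shift_class_scale_shift:
  assumes "w \<in> carrier SG" "c \<in> Units R"
  shows "shift_class (\<lambda>n. c \<otimes> w (n + m)) = shift_class w"
  using assms carrier_scale_shift[OF assms] shift_class_eq_iff by blast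

lemma scale_class_imp_shift_class:
  assumes "w \<in> carrier SG" "v \<in> carrier SG" "scale_class w = scale_class v"
  shows "shift_class w = shift_class v"
  using assms shift_class_scale_shift[OF assms(2), where m = 0]
  by (auto simp: scale_class_eq_iff)

lemma scale_class_eq_one_iff:
  assumes w: "w \<in> carrier SG"
  shows "scale_class w = \<one>\<^bsub>G_grp R P Q\<^esub> \<longleftrightarrow> w 0 = \<zero>"
proof -
  have "(\<exists>c\<in>Units R. w = (\<lambda>n. c \<otimes> \<one>\<^bsub>SG\<^esub> n)) \<longleftrightarrow> w 0 = \<zero>"
  proof
    assume "w 0 = \<zero>"
    moreover have "w 1 \<in> carrier R"
      using carrier_seqs[OF w] by simp
    ultimately have unit: "w 1 \<in> Units R"
      using w unit_factor[of "w 1" "w 1"] by (simp add: carrier_seq_group Lam_eq a_minus_def)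
    have "w = (\<lambda>n. w 1 \<otimes> \<one>\<^bsub>SG\<^esub> n)"
      using carrier_seqs[OF w] \<open>w 0 = \<zero>\<close> by (intro rec_seqs_eqI rec_seqs_scale) simp_all
    with unit show "\<exists>c\<in>Units R. w = (\<lambda>n. c \<otimes> \<one>\<^bsub>SG\<^esub> n)" ..
  qed auto
  then show ?thesis
    using scale_class_eq_iff[OF w SG.one_closed] by simp
qed

lemma shift_class_eq_one_iff:
  assumes w: "w \<in> carrier SG"
  shows "shift_class w = \<one>\<^bsub>Gs_grp R P Q\<^esub> \<longleftrightarrow> (\<exists>n. w n = \<zero>)"
proof
  assume "shift_class w = \<one>\<^bsub>Gs_grp R P Q\<^esub>"
  then obtain c m where "c \<in> Units R" "w = (\<lambda>n. c \<otimes> \<one>\<^bsub>SG\<^esub> (n + m))"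
    using shift_class_eq_iff[OF w SG.one_closed] by auto
  then have "w (- m) = \<zero>"
    by (simp add: Units_closed)
  then show "\<exists>n. w n = \<zero>" ..
next
  assume "\<exists>n. w n = \<zero>"
  then obtain n where n: "w n = \<zero>" ..
  let ?v = "\<lambda>k. \<one> \<otimes> w (k + n)"
  have v: "?v \<in> carrier SG"
    by (rule carrier_scale_shift[OF w Units_one_closed])
  have "scale_class ?v = scale_class \<one>\<^bsub>SG\<^esub>"
    using scale_class_eq_one_iff[OF v] n by simp
  then have "shift_class ?v = shift_class \<one>\<^bsub>SG\<^esub>"
    by (rule scale_class_imp_shift_class[OF v SG.one_closed])
  then show "shift_class w = \<one>\<^bsub>Gs_grp R P Q\<^esub>"
    by (simp only: shift_class_scale_shift[OF w Units_one_closed] shift_class.hom_one)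
qed

lemma to_proj_scale_class:
  assumes w: "w \<in> carrier SG"
  shows "to_proj (scale_class w) = proj_pt R (w 1) (w 0)"
proof -
  have "(\<lambda>n. c \<otimes> w n) \<in> scale_class w" if "c \<in> Units R" for c
    using that carrier_scale_shift[OF w that, of 0] scale_class_eq_iff[OF _ w]
    by (auto simp: mem_scale_class_iff[OF w])
  moreover have "\<exists>c\<in>Units R. v = (\<lambda>n. c \<otimes> w n)" if "v \<in> scale_class w" for v
    using that scale_class_eq_iff[OF _ w] by (auto simp: mem_scale_class_iff[OF w])
  ultimately have "scale_class w = {(\<lambda>n. c \<otimes> w n) | c. c \<in> Units R}"
    by blast
  then show ?thesis
    by (auto simp: to_proj_def proj_pt_def)
qed

lemma proj_pt_eq_iff:
  assumes w: "w \<in> seqs" and v: "v \<in> seqs"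
  shows "proj_pt R (w 1) (w 0) = proj_pt R (v 1) (v 0) \<longleftrightarrow> (\<exists>c\<in>Units R. w = (\<lambda>n. c \<otimes> v n))"
proof
  assume "proj_pt R (w 1) (w 0) = proj_pt R (v 1) (v 0)"
  moreover have "(w 1, w 0) \<in> proj_pt R (w 1) (w 0)"
    using w unfolding proj_pt_def by (auto intro!: exI[of _ \<one>])
  ultimately obtain c where c: "c \<in> Units R" "w 1 = c \<otimes> v 1" "w 0 = c \<otimes> v 0"
    by (auto simp: proj_pt_def)
  then have "w = (\<lambda>n. c \<otimes> v n)"
    using w v by (intro rec_seqs_eqI rec_seqs_scale Units_closed)
  with c(1) show "\<exists>c\<in>Units R. w = (\<lambda>n. c \<otimes> v n)" ..
qed (use v in \<open>auto simp: proj_pt_scale\<close>)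

abbreviation "scale_to_shift \<equiv> (``) (shift_rel R (carrier SG))"

sublocale proj: subcongruence SG "shift_rel R (carrier SG)" "carrier SG" "scale_rel R (carrier SG)"
proof (intro subcongruence.intro subcongruence_axioms.intro)
  show "monoid_congruence SG (shift_rel R (carrier SG))"
    by (rule shift.monoid_congruence_axioms)
  show "monoid_congruence (SG\<lparr>carrier := carrier SG\<rparr>) (scale_rel R (carrier SG))"
    using scale.monoid_congruence_axioms by simp
  show "scale_rel R (carrier SG) \<subseteq> shift_rel R (carrier SG)"
    unfolding scale_rel_eq shift_rel_eq scale_shift_rel_def by blast
qed (rule submonoid_carrier)

lemma scale_to_shift_class: "w \<in> carrier SG \<Longrightarrow> scale_to_shift (scale_class w) = shift_class w"
  unfolding scale_class_def shift_class_def by (rule proj.Image_class)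

sublocale scale_to_shift: group_hom "G_grp R P Q" "Gs_grp R P Q" scale_to_shift
  using proj.Image_hom
  by unfold_locales (simp add: G_grp_def Gs_grp_def)

lemma scale_to_shift_image:
  "S \<subseteq> carrier SG \<Longrightarrow> scale_to_shift ` scale_class ` S = shift_class ` S"
  unfolding image_image by (intro image_cong refl scale_to_shift_class) blast

lemma scale_to_shift_surj: "scale_to_shift ` carrier (G_grp R P Q) = carrier (Gs_grp R P Q)"
  by (simp add: carrier_G_grp carrier_Gs_grp scale_to_shift_image)

lemma kernel_scale_to_shift:
  assumes "x \<in> kernel (G_grp R P Q) (Gs_grp R P Q) scale_to_shift"
  obtains m where "x = scale_class (\<lambda>n. \<one>\<^bsub>SG\<^esub> (n + m))"
proof -
  have x: "x \<in> carrier (G_grp R P Q)" "scale_to_shift x = \<one>\<^bsub>Gs_grp R P Q\<^esub>"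
    using assms by (simp_all add: kernel_def)
  then obtain w where w: "w \<in> carrier SG" "x = scale_class w"
    by (auto simp: carrier_G_grp)
  with x(2) have "shift_class w = shift_class \<one>\<^bsub>SG\<^esub>"
    by (simp add: scale_to_shift_class)
  then obtain c m where c: "c \<in> Units R" "w = (\<lambda>n. c \<otimes> \<one>\<^bsub>SG\<^esub> (n + m))"
    using shift_class_eq_iff[OF w(1) SG.one_closed] by blast
  moreover have "(\<lambda>n. \<one>\<^bsub>SG\<^esub> (n + m)) \<in> carrier SG"
    using carrier_scale_shift[OF SG.one_closed Units_one_closed, of m] by simp
  ultimately have "scale_class w = scale_class (\<lambda>n. \<one>\<^bsub>SG\<^esub> (n + m))"
    using scale_class_eq_iff[OF w(1)] by blast
  with w(2) show ?thesis
    by (intro that) simp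
qed

end

subsection \<open>Functoriality\<close>

lemma (in ring_hom_cring) hom_Units:
  assumes "x \<in> Units R"
  shows "h x \<in> Units S"
proof (rule S.unit_factor)
  have "h x \<otimes>\<^bsub>S\<^esub> h (inv x) = h (x \<otimes> inv x)"
    using assms by (intro hom_mult[symmetric]) auto
  then show "h x \<otimes>\<^bsub>S\<^esub> h (inv x) \<in> Units S"
    using assms by simp
qed (use assms in auto)

lemma (in ring_hom_cring) hom_minus:
  "x \<in> carrier R \<Longrightarrow> y \<in> carrier R \<Longrightarrow> h (x \<ominus> y) = h x \<ominus>\<^bsub>S\<^esub> h y"
  by (simp add: a_minus_def)

locale recurrence_hom = source: recurrence R P Q + ring_hom_cring R S h
  for R (structure) and P Q and S (structure) and P' Q' h +
  assumes hom_P [simp]: "h P = P'" and hom_Q [simp]: "h Q = Q'"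

sublocale recurrence_hom \<subseteq> target: recurrence S P' Q'
  using hom_Units[OF source.Q_unit] hom_closed[OF source.P_closed] by unfold_locales simp_all

context recurrence_hom
begin

lemma hom_rec_seqs: "w \<in> source.seqs \<Longrightarrow> h \<circ> w \<in> target.seqs"
  by (rule target.rec_seqsI)
    (simp_all add: source.rec_step hom_minus)

lemma hom_Lam:
  assumes "x \<in> carrier R" "y \<in> carrier R"
  shows "h (source.\<Lambda> x y) = target.\<Lambda> (h x) (h y)"
  using assms by (simp add: source.Lam_eq S.Lam_eq hom_minus)

lemma hom_seq_mult:
  assumes "w \<in> source.seqs" "v \<in> source.seqs"
  shows "h \<circ> (w \<otimes>\<^bsub>source.SG\<^esub> v) = (h \<circ> w) \<otimes>\<^bsub>target.SG\<^esub> (h \<circ> v)"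
  using assms
  by (intro target.rec_seqs_eqI hom_rec_seqs target.mult_closed source.mult_closed)
    (simp_all add: hom_rec_seqs source.mult_1 target.mult_1 source.mult_0 target.mult_0
      hom_minus)

sublocale seq_hom: group_hom source.SG target.SG "(\<circ>) h"
proof -
  have "h \<circ> w \<in> carrier target.SG" if "w \<in> carrier source.SG" for w
    using that hom_Units[of "source.\<Lambda> (w 1) (w 0)"]
    by (simp add: source.carrier_seq_group target.carrier_seq_group hom_rec_seqs hom_Lam)
  then show "group_hom source.SG target.SG ((\<circ>) h)"
    by unfold_locales (auto simp: hom_def hom_seq_mult source.carrier_seqs)
qed

lemma shift_class_hom:
  assumes w: "w \<in> carrier source.SG" and v: "v \<in> carrier source.SG"
    and eq: "source.shift_class w = source.shift_class v"
  shows "target.shift_class (h \<circ> w) = target.shift_class (h \<circ> v)"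
proof -
  obtain c m where c: "c \<in> Units R" "w = (\<lambda>n. c \<otimes> v (n + m))"
    using eq source.shift_class_eq_iff[OF w v] by blast
  then have "h \<circ> w = (\<lambda>n. h c \<otimes>\<^bsub>S\<^esub> (h \<circ> v) (n + m))"
    using source.carrier_seqs[OF v] by (auto simp: source.Units_closed)
  then show ?thesis
    using target.shift_class_eq_iff[OF seq_hom.hom_closed[OF w] seq_hom.hom_closed[OF v]]
      hom_Units[OF c(1)] by blast
qed

end

section \<open>Reduction to the residue field of a local subring\<close>

locale local_reduction = K: cring K + F: field F
  for K (structure) and P Q and F (structure) and P' Q' A and \<rho> +
  assumes subcring: "subcring A K"
    and reduction_hom: "\<rho> \<in> ring_hom (K\<lparr>carrier := A\<rparr>) F"
    and reduction_surj: "\<rho> ` A = carrier F"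
    and local_unit: "x \<in> A \<Longrightarrow> \<rho> x \<noteq> \<zero>\<^bsub>F\<^esub> \<Longrightarrow> x \<in> Units (K\<lparr>carrier := A\<rparr>)"
    and P_mem: "P \<in> A" and Q_mem: "Q \<in> A"
    and reduction_P: "\<rho> P = P'" and reduction_Q: "\<rho> Q = Q'" and Q'_nonzero: "Q' \<noteq> \<zero>\<^bsub>F\<^esub>"
begin

abbreviation "\<O> \<equiv> K\<lparr>carrier := A\<rparr>"

lemma A_subset: "A \<subseteq> carrier K"
  using subcring by (rule subcringE)

sublocale \<O>: cring \<O>
  using subcring K.subcring_iff[OF A_subset] by blast

sublocale \<O>: recurrence \<O> P Q
  using P_mem Q_mem local_unit[of Q] reduction_Q Q'_nonzero by unfold_locales auto

sublocale K: recurrence K P Q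
proof
  show "P \<in> carrier K"
    using P_mem A_subset by blast
  show "Q \<in> Units K"
    using \<O>.Q_unit A_subset by (auto simp: Units_def)
qed

sublocale F: recurrence F P' Q'
  using P_mem Q_mem reduction_P reduction_Q Q'_nonzero reduction_surj F.field_Units
  by unfold_locales auto

sublocale incl: recurrence_hom \<O> P Q K P Q id
  using A_subset by unfold_locales (auto simp: ring_hom_def)

sublocale red: recurrence_hom \<O> P Q F P' Q' \<rho>
  using reduction_hom reduction_P reduction_Q by unfold_locales

lemma local_unit_iff: "x \<in> A \<Longrightarrow> x \<in> Units \<O> \<longleftrightarrow> \<rho> x \<noteq> \<zero>\<^bsub>F\<^esub>"
  using local_unit[of x] red.hom_Units[of x] F.field_Units by auto

lemma local_seqs_subset: "\<O>.seqs \<subseteq> K.seqs"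
  using incl.hom_rec_seqs by auto

lemma local_seqsI:
  assumes w: "w \<in> K.seqs" and init: "w 1 \<in> A" "w 0 \<in> A"
  shows "w \<in> \<O>.seqs"
proof -
  obtain v where v: "v \<in> \<O>.seqs" "v 1 = w 1" "v 0 = w 0"
    using \<O>.rec_seqs_exist[of "w 1" "w 0"] init by auto
  then have "w = v"
    using w local_seqs_subset by (intro K.rec_seqs_eqI) auto
  with v(1) show ?thesis
    by simp
qed

lemma local_group_subgroup: "subgroup (carrier \<O>.SG) K.SG"
  using incl.seq_hom.img_is_subgroup by simp

lemma local_group_subset: "carrier \<O>.SG \<subseteq> carrier K.SG"
  by (rule subgroup.subset[OF local_group_subgroup])

lemma reduction_seq: "w \<in> \<O>.seqs \<Longrightarrow> \<rho> \<circ> w \<in> F.seqs"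
  by (rule red.hom_rec_seqs)

lemma local_group_iff:
  assumes w: "w \<in> \<O>.seqs"
  shows "w \<in> carrier \<O>.SG \<longleftrightarrow> \<rho> \<circ> w \<in> carrier F.SG"
proof -
  have mem: "w 1 \<in> A" "w 0 \<in> A"
    using w \<O>.rec_closed by auto
  then have "\<O>.\<Lambda> (w 1) (w 0) \<in> A"
    using \<O>.Lam_closed by auto
  then show ?thesis
    using w mem reduction_seq[OF w] F.field_Units
    by (auto simp: \<O>.carrier_seq_group F.carrier_seq_group local_unit_iff red.hom_Lam)
qed

lemma reduction_group_surj: "(\<circ>) \<rho> ` carrier \<O>.SG = carrier F.SG"
proof (intro equalityI image_subsetI subsetI)
  fix u assume u: "u \<in> carrier F.SG"
  then obtain x y where xy: "x \<in> A" "y \<in> A" "\<rho> x = u 1" "\<rho> y = u 0"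
    using F.rec_closed[OF F.carrier_seqs[OF u]] by (metis imageE reduction_surj)
  then obtain w where w: "w \<in> \<O>.seqs" "w 1 = x" "w 0 = y"
    using \<O>.rec_seqs_exist[of x y] by auto
  then have "\<rho> \<circ> w = u"
    using xy u by (intro F.rec_seqs_eqI reduction_seq F.carrier_seqs) simp_all
  then show "u \<in> (\<circ>) \<rho> ` carrier \<O>.SG"
    using local_group_iff[OF w(1)] u by blast
qed (rule red.seq_hom.hom_closed)

subsection \<open>Primitive sequences\<close>

definition primitive :: "(int \<Rightarrow> 'a) \<Rightarrow> bool" where
  "primitive w \<longleftrightarrow> w \<in> \<O>.seqs \<and> (\<exists>n. \<rho> (w n) \<noteq> \<zero>\<^bsub>F\<^esub>)"

lemma primitive_seqs: "primitive w \<Longrightarrow> w \<in> \<O>.seqs"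
  by (simp add: primitive_def)

lemma primitive_mem: "primitive w \<Longrightarrow> w n \<in> A"
  using \<O>.rec_closed[OF primitive_seqs, of w n] by simp

lemma primitive_consecutive:
  assumes "primitive w"
  shows "\<rho> (w m) \<noteq> \<zero>\<^bsub>F\<^esub> \<or> \<rho> (w (m + 1)) \<noteq> \<zero>\<^bsub>F\<^esub>"
proof (rule ccontr)
  assume "\<not> ?thesis"
  moreover have "(\<lambda>n. (\<rho> \<circ> w) (n + m)) \<in> F.seqs"
    by (rule F.rec_seqs_shift[OF reduction_seq[OF primitive_seqs[OF assms]]])
  ultimately have "(\<lambda>n. (\<rho> \<circ> w) (n + m)) = (\<lambda>n. \<zero>\<^bsub>F\<^esub>)"
    by (intro F.rec_seqs_eqI[OF _ F.rec_seqs_zero]) (simp_all add: add.commute)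
  from fun_cong[OF this, of "n - m" for n] have "\<rho> (w n) = \<zero>\<^bsub>F\<^esub>" for n
    by simp
  with assms show False
    by (simp add: primitive_def)
qed

lemma local_group_primitive:
  assumes w: "w \<in> carrier \<O>.SG"
  shows "primitive w"
proof (rule ccontr)
  assume "\<not> primitive w"
  then have "\<rho> \<circ> w = (\<lambda>n. \<zero>\<^bsub>F\<^esub>)"
    using \<O>.carrier_seqs[OF w] by (auto simp: primitive_def)
  then have "\<zero>\<^bsub>F\<^esub> \<in> Units F"
    using red.seq_hom.hom_closed[OF w]
    by (simp add: F.carrier_seq_group F.Lam_eq a_minus_def)
  then show False
    using F.field_Units by auto
qed

lemma ratio_mem:
  assumes v: "primitive v" and w: "\<And>n. k \<le> n \<Longrightarrow> w n \<in> A"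
    and c: "c \<in> carrier K" "w = (\<lambda>n. c \<otimes> v (n + m))"
  shows "c \<in> A"
proof -
  obtain i where i: "k \<le> i" "\<rho> (v (i + m)) \<noteq> \<zero>\<^bsub>F\<^esub>"
    using primitive_consecutive[OF v, of "k + m"]
    by (metis add.assoc add.commute order_refl zle_add1_eq_le less_add_one less_imp_le)
  have unit: "v (i + m) \<in> Units \<O>"
    using i(2) local_unit_iff[OF primitive_mem[OF v]] by blast
  let ?y = "inv\<^bsub>\<O>\<^esub> v (i + m)"
  have y: "?y \<in> A" "v (i + m) \<otimes> ?y = \<one>"
    using \<O>.Units_inv_closed[OF unit] \<O>.Units_r_inv[OF unit] by simp_all
  then have "w i \<otimes> ?y = c \<otimes> (v (i + m) \<otimes> ?y)"
    using c primitive_mem[OF v] A_subset by (simp add: K.m_assoc subset_iff)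
  with y(2) c(1) have "w i \<otimes> ?y = c"
    by simp
  then show ?thesis
    using \<O>.m_closed[of "w i" ?y] w[OF i(1)] y(1) by simp
qed

lemma ratio_unit:
  assumes v: "primitive v" and w: "primitive w"
    and c: "c \<in> carrier K" "w = (\<lambda>n. c \<otimes> v (n + m))"
  shows "c \<in> Units \<O>"
proof -
  have mem: "c \<in> A"
    using primitive_mem[OF w] by (rule ratio_mem[OF v _ c])
  obtain n where "\<rho> (w n) \<noteq> \<zero>\<^bsub>F\<^esub>"
    using w by (auto simp: primitive_def)
  then have "\<rho> c \<noteq> \<zero>\<^bsub>F\<^esub>"
    using red.hom_mult[of c "v (n + m)"] mem primitive_mem[OF v] c(2) by auto
  with mem show ?thesis
    by (rule local_unit)
qed

lemma reduction_scale_shift: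
  assumes "v \<in> \<O>.seqs" "c \<in> A"
  shows "\<rho> \<circ> (\<lambda>n. c \<otimes> v (n + m)) = (\<lambda>n. \<rho> c \<otimes>\<^bsub>F\<^esub> (\<rho> \<circ> v) (n + m))"
  using assms \<O>.rec_closed[OF assms(1)] red.hom_mult by (auto simp: fun_eq_iff)

lemma primitive_similar_reduction:
  assumes v: "primitive v" and w: "primitive w"
    and c: "c \<in> carrier K" "w = (\<lambda>n. c \<otimes> v (n + m))"
  shows "\<exists>d\<in>Units F. \<rho> \<circ> w = (\<lambda>n. d \<otimes>\<^bsub>F\<^esub> (\<rho> \<circ> v) (n + m))"
proof -
  have "c \<in> Units \<O>"
    by (rule ratio_unit[OF v w c])
  then show ?thesis
    using reduction_scale_shift[OF primitive_seqs[OF v], of c m] \<O>.Units_closed[of c]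
      red.hom_Units c(2) by auto
qed

lemma primitive_shift_class_local:
  assumes v: "v \<in> carrier \<O>.SG" and w: "primitive w" "w \<in> carrier K.SG"
    and eq: "K.shift_class w = K.shift_class v"
  shows "w \<in> carrier \<O>.SG" and "F.shift_class (\<rho> \<circ> w) = F.shift_class (\<rho> \<circ> v)"
proof -
  obtain c m where c: "c \<in> carrier K" "w = (\<lambda>n. c \<otimes> v (n + m))"
    using eq K.shift_class_eq_iff[OF w(2) subsetD[OF local_group_subset v]] K.Units_closed by blast
  have unit: "c \<in> Units \<O>"
    by (rule ratio_unit[OF local_group_primitive[OF v] w(1) c])
  with v show mem: "w \<in> carrier \<O>.SG"
    using \<O>.carrier_scale_shift[OF v, of c m] c(2) by simp
  have "\<O>.shift_class w = \<O>.shift_class v"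
    using \<O>.shift_class_scale_shift[OF v unit] c(2) by simp
  then show "F.shift_class (\<rho> \<circ> w) = F.shift_class (\<rho> \<circ> v)"
    by (rule red.shift_class_hom[OF mem v])
qed

lemma primitive_scale_class_proj_pt:
  assumes v: "primitive v" "v \<in> carrier K.SG" and w: "primitive w" "w \<in> carrier K.SG"
    and eq: "K.scale_class w = K.scale_class v"
  shows "proj_pt F (\<rho> (w 1)) (\<rho> (w 0)) = proj_pt F (\<rho> (v 1)) (\<rho> (v 0))"
proof -
  obtain c where c: "c \<in> carrier K" "w = (\<lambda>n. c \<otimes> v (n + 0))"
    using eq K.scale_class_eq_iff[OF w(2) v(2)] K.Units_closed by auto
  have "\<exists>d\<in>Units F. \<rho> \<circ> w = (\<lambda>n. d \<otimes>\<^bsub>F\<^esub> (\<rho> \<circ> v) n)"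
    using primitive_similar_reduction[OF v(1) w(1) c] by simp
  then show ?thesis
    using F.proj_pt_eq_iff[OF reduction_seq[OF primitive_seqs[OF w(1)]]
        reduction_seq[OF primitive_seqs[OF v(1)]]] by simp
qed

lemma primitive_proj_pt_iff:
  assumes w: "primitive w" "w \<in> carrier K.SG"
  shows "(\<exists>u\<in>carrier F.SG. proj_pt F (\<rho> (w 1)) (\<rho> (w 0)) = proj_pt F (u 1) (u 0)) \<longleftrightarrow>
    w \<in> carrier \<O>.SG"
proof
  assume "\<exists>u\<in>carrier F.SG. proj_pt F (\<rho> (w 1)) (\<rho> (w 0)) = proj_pt F (u 1) (u 0)"
  then obtain u c where u: "u \<in> carrier F.SG" and c: "c \<in> Units F"
    and eq: "\<rho> \<circ> w = (\<lambda>n. c \<otimes>\<^bsub>F\<^esub> u (n + 0))"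
    using F.proj_pt_eq_iff[OF reduction_seq[OF primitive_seqs[OF w(1)]] F.carrier_seqs] by auto
  have "\<rho> \<circ> w \<in> carrier F.SG"
    unfolding eq by (rule F.carrier_scale_shift[OF u c])
  then show "w \<in> carrier \<O>.SG"
    using local_group_iff[OF primitive_seqs[OF w(1)]] by simp
next
  assume "w \<in> carrier \<O>.SG"
  then show "\<exists>u\<in>carrier F.SG. proj_pt F (\<rho> (w 1)) (\<rho> (w 0)) = proj_pt F (u 1) (u 0)"
    using red.seq_hom.hom_closed by (intro bexI[of _ "\<rho> \<circ> w"]) simp_all
qed

subsection \<open>The kernel of the reduction\<close>

definition reduction_kernel :: "(int \<Rightarrow> 'a) set" where
  "reduction_kernel = kernel \<O>.SG (G_grp F P' Q') (F.scale_class \<circ> (\<circ>) \<rho>)"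

lemma mem_reduction_kernel_iff:
  "w \<in> reduction_kernel \<longleftrightarrow> w \<in> carrier \<O>.SG \<and> \<rho> (w 0) = \<zero>\<^bsub>F\<^esub>"
  using F.scale_class_eq_one_iff[OF red.seq_hom.hom_closed]
  by (auto simp: reduction_kernel_def kernel_def)

sublocale scale_red: group_hom \<O>.SG "G_grp F P' Q'" "F.scale_class \<circ> (\<circ>) \<rho>"
  using Group.hom_compose[OF red.seq_hom.homh F.scale_class.homh] by unfold_locales

lemma reduction_kernel_subset: "reduction_kernel \<subseteq> carrier \<O>.SG"
  by (auto simp: mem_reduction_kernel_iff)

lemma reduction_kernel_subgroup: "subgroup reduction_kernel K.SG"
  using incl.seq_hom.subgroup_img_is_subgroup[OF scale_red.subgroup_kernel]
  by (simp add: reduction_kernel_def)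

lemma primitive_proj_pt_one_iff:
  assumes w: "primitive w" "w \<in> carrier K.SG"
  shows "proj_pt F (\<rho> (w 1)) (\<rho> (w 0)) = proj_pt F \<one>\<^bsub>F\<^esub> \<zero>\<^bsub>F\<^esub> \<longleftrightarrow> w \<in> reduction_kernel"
proof -
  have pt: "proj_pt F (\<rho> (w 1)) (\<rho> (w 0)) = proj_pt F \<one>\<^bsub>F\<^esub> \<zero>\<^bsub>F\<^esub> \<longleftrightarrow>
      (\<exists>c\<in>Units F. \<rho> \<circ> w = (\<lambda>n. c \<otimes>\<^bsub>F\<^esub> \<one>\<^bsub>F.SG\<^esub> n))"
    using F.proj_pt_eq_iff[OF reduction_seq[OF primitive_seqs[OF w(1)]] F.one_seq(1)] by simp
  have "w \<in> carrier \<O>.SG" if "proj_pt F (\<rho> (w 1)) (\<rho> (w 0)) = proj_pt F \<one>\<^bsub>F\<^esub> \<zero>\<^bsub>F\<^esub>"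
    using that primitive_proj_pt_iff[OF w] F.SG.one_closed F.one_seq(2,3) by metis
  moreover have "(\<exists>c\<in>Units F. \<rho> \<circ> w = (\<lambda>n. c \<otimes>\<^bsub>F\<^esub> \<one>\<^bsub>F.SG\<^esub> n)) \<longleftrightarrow> \<rho> (w 0) = \<zero>\<^bsub>F\<^esub>"
    if "w \<in> carrier \<O>.SG"
    using F.scale_class_eq_iff[OF red.seq_hom.hom_closed[OF that] F.SG.one_closed]
      F.scale_class_eq_one_iff[OF red.seq_hom.hom_closed[OF that]] by simp
  ultimately show ?thesis
    using pt mem_reduction_kernel_iff by blast
qed

abbreviation "Gs_kernel \<equiv> K.shift_class ` reduction_kernel"
abbreviation "Gs_local \<equiv> K.shift_class ` carrier \<O>.SG"

lemma reduction_shift_class_eq_one_iff: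
  assumes w: "w \<in> carrier \<O>.SG"
  shows "F.shift_class (\<rho> \<circ> w) = \<one>\<^bsub>Gs_grp F P' Q'\<^esub> \<longleftrightarrow>
    K.shift_class w \<in> Gs_kernel"
proof
  assume "F.shift_class (\<rho> \<circ> w) = \<one>\<^bsub>Gs_grp F P' Q'\<^esub>"
  then obtain n where n: "\<rho> (w n) = \<zero>\<^bsub>F\<^esub>"
    using F.shift_class_eq_one_iff[OF red.seq_hom.hom_closed[OF w]] by auto
  let ?v = "\<lambda>k. \<one> \<otimes> w (k + n)"
  have "?v \<in> carrier \<O>.SG"
    using \<O>.carrier_scale_shift[OF w \<O>.Units_one_closed, of n] by simp
  moreover have "w n \<in> carrier K"
    by (rule K.rec_closed[OF K.carrier_seqs[OF subsetD[OF local_group_subset w]]])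
  ultimately have v_kernel: "?v \<in> reduction_kernel"
    using n by (simp add: mem_reduction_kernel_iff)
  have "K.shift_class w = K.shift_class ?v"
    by (rule K.shift_class_scale_shift[OF subsetD[OF local_group_subset w] K.Units_one_closed,
          symmetric])
  then show "K.shift_class w \<in> Gs_kernel"
    using v_kernel by (rule image_eqI)
next
  assume "K.shift_class w \<in> Gs_kernel"
  then obtain v where v: "v \<in> carrier \<O>.SG" "\<rho> (v 0) = \<zero>\<^bsub>F\<^esub>" "K.shift_class w = K.shift_class v"
    by (auto simp: mem_reduction_kernel_iff)
  have "F.shift_class (\<rho> \<circ> w) = F.shift_class (\<rho> \<circ> v)"
    using w local_group_subset
    by (intro primitive_shift_class_local(2)[OF v(1) local_group_primitive[OF w] _ v(3)]) auto
  also have "\<dots> = \<one>\<^bsub>Gs_grp F P' Q'\<^esub>"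
    using v(2) F.shift_class_eq_one_iff[OF red.seq_hom.hom_closed[OF v(1)]] by auto
  finally show "F.shift_class (\<rho> \<circ> w) = \<one>\<^bsub>Gs_grp F P' Q'\<^esub>" .
qed

lemma primitive_mem_Gs_local_iff:
  assumes w: "primitive w" "w \<in> carrier K.SG"
  shows "K.shift_class w \<in> Gs_local \<longleftrightarrow> w \<in> carrier \<O>.SG"
  using primitive_shift_class_local(1)[OF _ w] by auto

lemma primitive_zero_local:
  assumes w: "primitive w" and zero: "\<rho> (w m) = \<zero>\<^bsub>F\<^esub>"
  shows "w \<in> carrier \<O>.SG"
proof -
  have mem: "w n \<in> carrier \<O>" for n
    using primitive_mem[OF w] by simp
  have "\<rho> (w (m + 1)) \<in> Units F"
    using primitive_consecutive[OF w, of m] zero red.hom_closed[OF mem] F.field_Units by auto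
  then have "\<rho> (\<O>.\<Lambda> (w (m + 1)) (w m)) \<in> Units F"
    using mem zero by (simp add: red.hom_Lam F.Lam_eq F.Units_closed a_minus_def)
  then have "\<O>.\<Lambda> (w (m + 1)) (w m) \<in> Units \<O>"
    using \<O>.Lam_closed[OF mem mem] F.field_Units by (intro local_unit) auto
  then show ?thesis
    using \<O>.Lam_unit_shift[OF primitive_seqs[OF w]] primitive_seqs[OF w]
    by (simp add: \<O>.carrier_seq_group)
qed

lemma primitive_mem_Gs_kernel_iff:
  assumes w: "primitive w" "w \<in> carrier K.SG"
  shows "K.shift_class w \<in> Gs_kernel \<longleftrightarrow> (\<exists>n. \<rho> (w n) = \<zero>\<^bsub>F\<^esub>)"
proof -
  have "K.shift_class w \<in> Gs_kernel \<longleftrightarrow> (\<exists>n. \<rho> (w n) = \<zero>\<^bsub>F\<^esub>)" if "w \<in> carrier \<O>.SG"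
    using reduction_shift_class_eq_one_iff[OF that]
      F.shift_class_eq_one_iff[OF red.seq_hom.hom_closed[OF that]] by simp
  moreover have "w \<in> carrier \<O>.SG" if "K.shift_class w \<in> Gs_kernel"
    using subsetD[OF image_mono[OF reduction_kernel_subset] that]
    by (simp only: primitive_mem_Gs_local_iff[OF w])
  ultimately show ?thesis
    using primitive_zero_local[OF w(1)] by (metis (lifting))
qed

lemma eventually_local_zero:
  assumes v: "v \<in> carrier K.SG" "\<And>n. k \<le> n \<Longrightarrow> v n \<in> A"
    and w: "primitive w" "w \<in> carrier K.SG" "\<rho> (w i) = \<zero>\<^bsub>F\<^esub>"
    and eq: "K.shift_class v = K.shift_class w"
  shows "\<exists>n. v n \<in> A \<and> \<rho> (v n) = \<zero>\<^bsub>F\<^esub>"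
proof -
  obtain c m where c: "c \<in> carrier K" "v = (\<lambda>n. c \<otimes> w (n + m))"
    using eq K.shift_class_eq_iff[OF v(1) w(2)] K.Units_closed by blast
  have "c \<in> A"
    by (rule ratio_mem[OF w(1) v(2) c])
  then have "v (i - m) \<in> A \<and> \<rho> (v (i - m)) = \<zero>\<^bsub>F\<^esub>"
    using \<O>.m_closed[of c "w i"] red.hom_mult[of c "w i"] red.hom_closed[of c]
      primitive_mem[OF w(1)] w(3) c(2) by simp
  then show ?thesis ..
qed

lemma Gs_kernel_subgroup: "subgroup Gs_kernel (Gs_grp K P Q)"
  by (rule K.shift_class.subgroup_img_is_subgroup[OF reduction_kernel_subgroup])

lemma Gs_local_subgroup: "subgroup Gs_local (Gs_grp K P Q)"
  by (rule K.shift_class.subgroup_img_is_subgroup[OF local_group_subgroup])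

context
  fixes g
  assumes g_shift_class: "\<And>w. w \<in> carrier \<O>.SG \<Longrightarrow> g (K.shift_class w) = F.shift_class (\<rho> \<circ> w)"
begin

lemma group_hom_reduction: "group_hom (Gs_grp K P Q\<lparr>carrier := Gs_local\<rparr>) (Gs_grp F P' Q') g"
proof (intro group_hom.intro group_hom_axioms.intro F.Gs.group_axioms homI
    subgroup.subgroup_is_group[OF Gs_local_subgroup K.Gs.group_axioms])
  fix V W
  assume "V \<in> carrier (Gs_grp K P Q\<lparr>carrier := Gs_local\<rparr>)"
    "W \<in> carrier (Gs_grp K P Q\<lparr>carrier := Gs_local\<rparr>)"
  then obtain v w where v: "v \<in> carrier \<O>.SG" "V = K.shift_class v"
    and w: "w \<in> carrier \<O>.SG" "W = K.shift_class w"
    by auto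
  then show "g V \<in> carrier (Gs_grp F P' Q')"
    by (simp add: g_shift_class)
  have "V \<otimes>\<^bsub>Gs_grp K P Q\<^esub> W = K.shift_class (v \<otimes>\<^bsub>\<O>.SG\<^esub> w)"
    using v w incl.seq_hom.hom_mult[OF v(1) w(1)] local_group_subset
    by (simp add: K.shift_class.hom_mult subset_iff)
  then have "g (V \<otimes>\<^bsub>Gs_grp K P Q\<^esub> W) = F.shift_class ((\<rho> \<circ> v) \<otimes>\<^bsub>F.SG\<^esub> (\<rho> \<circ> w))"
    using v w by (simp add: g_shift_class)
  also have "\<dots> = g V \<otimes>\<^bsub>Gs_grp F P' Q'\<^esub> g W"
    using v w red.seq_hom.hom_closed by (simp add: g_shift_class)
  finally show "g (V \<otimes>\<^bsub>Gs_grp K P Q\<lparr>carrier := Gs_local\<rparr>\<^esub> W) = g V \<otimes>\<^bsub>Gs_grp F P' Q'\<^esub> g W"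
    by simp
qed

lemma short_exact_reduction:
  "short_exact (Gs_grp K P Q\<lparr>carrier := Gs_kernel\<rparr>) (\<lambda>W. W)
    (Gs_grp K P Q\<lparr>carrier := Gs_local\<rparr>) g (Gs_grp F P' Q')"
  unfolding short_exact_def
proof (intro conjI group_hom_reduction)
  have subset: "Gs_kernel \<subseteq> Gs_local"
    using reduction_kernel_subset by blast
  then show "group_hom (Gs_grp K P Q\<lparr>carrier := Gs_kernel\<rparr>) (Gs_grp K P Q\<lparr>carrier := Gs_local\<rparr>)
      (\<lambda>W. W)"
    by (intro group_hom.intro group_hom_axioms.intro homI
        subgroup.subgroup_is_group[OF Gs_kernel_subgroup K.Gs.group_axioms]
        subgroup.subgroup_is_group[OF Gs_local_subgroup K.Gs.group_axioms]) auto
  have kernel_iff: "g W = \<one>\<^bsub>Gs_grp F P' Q'\<^esub> \<longleftrightarrow> W \<in> Gs_kernel" if W: "W \<in> Gs_local" for W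
  proof -
    obtain w where "w \<in> carrier \<O>.SG" "W = K.shift_class w"
      using W by blast
    then show ?thesis
      by (simp only: g_shift_class reduction_shift_class_eq_one_iff)
  qed
  have "kernel (Gs_grp K P Q\<lparr>carrier := Gs_local\<rparr>) (Gs_grp F P' Q') g =
      {W \<in> Gs_local. g W = \<one>\<^bsub>Gs_grp F P' Q'\<^esub>}"
    by (simp add: kernel_def)
  also have "\<dots> = {W \<in> Gs_local. W \<in> Gs_kernel}"
    using kernel_iff by (intro Collect_cong conj_cong refl)
  also have "\<dots> = Gs_kernel"
    using subset by (simp only: Collect_conj_eq Collect_mem_eq Int_absorb1)
  finally show "(\<lambda>W. W) ` carrier (Gs_grp K P Q\<lparr>carrier := Gs_kernel\<rparr>) =
      kernel (Gs_grp K P Q\<lparr>carrier := Gs_local\<rparr>) (Gs_grp F P' Q') g"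
    by simp
  have "g ` Gs_local = F.shift_class ` (\<circ>) \<rho> ` carrier \<O>.SG"
    by (simp add: image_image g_shift_class)
  then show "g ` carrier (Gs_grp K P Q\<lparr>carrier := Gs_local\<rparr>) = carrier (Gs_grp F P' Q')"
    by (simp add: reduction_group_surj F.carrier_Gs_grp)
qed simp

end

subsection \<open>Isolators\<close>

lemma local_group_isolator:
  assumes "finite (carrier F)"
  shows "carrier \<O>.SG \<subseteq> isolator K.SG reduction_kernel"
proof -
  have "carrier \<O>.SG = isolator \<O>.SG reduction_kernel"
    using scale_red.isolator_kernel F.finite_seq_group[OF assms]
    by (simp add: reduction_kernel_def F.carrier_G_grp)
  then show ?thesis
    using incl.seq_hom.image_isolator_subset[of reduction_kernel] by simp
qed

lemma isolator_scale_to_shift: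
  assumes "finite (carrier F)"
  shows "K.scale_to_shift ` isolator (G_grp K P Q) (K.scale_class ` reduction_kernel) =
    isolator (Gs_grp K P Q) Gs_kernel"
proof -
  have "kernel (G_grp K P Q) (Gs_grp K P Q) K.scale_to_shift \<subseteq>
      isolator (G_grp K P Q) (K.scale_class ` reduction_kernel)"
  proof
    fix x assume "x \<in> kernel (G_grp K P Q) (Gs_grp K P Q) K.scale_to_shift"
    then obtain m where x: "x = K.scale_class (\<lambda>n. \<one>\<^bsub>K.SG\<^esub> (n + m))"
      by (rule K.kernel_scale_to_shift)
    have "\<one>\<^bsub>K.SG\<^esub> \<in> carrier \<O>.SG"
      by (rule subgroup.one_closed[OF local_group_subgroup])
    then have "(\<lambda>n. \<one>\<^bsub>K.SG\<^esub> (n + m)) \<in> carrier \<O>.SG"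
      using \<O>.carrier_scale_shift[OF _ \<O>.Units_one_closed, of "\<one>\<^bsub>K.SG\<^esub>" m] by simp
    then have "x \<in> K.scale_class ` isolator K.SG reduction_kernel"
      unfolding x using local_group_isolator[OF assms] by blast
    then show "x \<in> isolator (G_grp K P Q) (K.scale_class ` reduction_kernel)"
      using K.scale_class.image_isolator_subset by blast
  qed
  moreover have "K.scale_to_shift ` K.scale_class ` reduction_kernel = Gs_kernel"
    by (rule K.scale_to_shift_image[OF subgroup.subset[OF reduction_kernel_subgroup]])
  ultimately show ?thesis
    using K.scale_to_shift.isolator_image[OF K.G.comm_group_axioms K.scale_to_shift_surj
        K.scale_class.subgroup_img_is_subgroup[OF reduction_kernel_subgroup]] by simp
qed

end

section \<open>Localization at a prime\<close>

lemma type_algebra_simps [simp]: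
  "carrier (ring_of_type_algebra :: 'a :: comm_ring_1 ring) = UNIV"
  "(x :: 'a) \<otimes>\<^bsub>ring_of_type_algebra\<^esub> y = x * y" "x \<oplus>\<^bsub>ring_of_type_algebra\<^esub> y = x + y"
  "\<one>\<^bsub>ring_of_type_algebra\<^esub> = (1 :: 'a)" "\<zero>\<^bsub>ring_of_type_algebra\<^esub> = (0 :: 'a)"
  by (simp_all add: ring_of_type_algebra_def)

lemma type_algebra_uminus [simp]: "\<ominus>\<^bsub>ring_of_type_algebra\<^esub> x = - (x :: 'a :: comm_ring_1)"
  by (rule abelian_group.minus_equality[OF ring.is_abelian_group[OF ring_from_type_algebra]])
    simp_all

lemma type_algebra_minus [simp]: "x \<ominus>\<^bsub>ring_of_type_algebra\<^esub> y = (x - y :: 'a :: comm_ring_1)"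
  by (simp add: a_minus_def)

lemma type_algebra_Units [simp]: "Units ring_of_type_algebra = - {0 :: 'a :: Fields.field}"
  by (subst field.field_Units[OF field_from_type_algebra]) auto

lemma type_algebra_Lam:
  "Lam ring_of_type_algebra P Q x y = x\<^sup>2 - P * y * x + Q * (y :: 'a :: comm_ring_1)\<^sup>2"
  using cring.Lam_eq[OF cring_from_type_algebra, of x y P Q] by (simp add: power2_eq_square)

lemma rat_pair_coprime:
  fixes x y :: rat
  assumes "x \<noteq> 0 \<or> y \<noteq> 0"
  obtains c :: rat and a b :: int
    where "c \<noteq> 0" "c * x = of_int a" "c * y = of_int b" "coprime a b"
proof -
  obtain a b c d where x: "x = of_int a / of_int b" "b \<noteq> 0" and y: "y = of_int c / of_int d" "d \<noteq> 0"
    by (metis Rat_cases Fract_of_int_quotient less_irrefl)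
  have "gcd (a * d) (c * b) \<noteq> 0"
    using assms x y by auto
  then obtain u v g where g: "g \<noteq> 0" "a * d = u * g" "c * b = v * g" and uv: "coprime u v"
    using gcd_coprime_exists by metis
  let ?c = "of_int (b * d) / of_int g :: rat"
  have "?c * x = of_int (a * d) / of_int g"
    using x by simp
  also have "\<dots> = of_int u"
    unfolding g(2) using g(1) by simp
  finally have cx: "?c * x = of_int u" .
  have "?c * y = of_int (c * b) / of_int g"
    using y by simp
  also have "\<dots> = of_int v"
    unfolding g(3) using g(1) by simp
  finally have cy: "?c * y = of_int v" .
  have "?c \<noteq> 0"
    using x(2) y(2) g(1) by simp
  then show ?thesis
    using cx cy uv by (rule that)
qed

definition p_local_ring :: "nat \<Rightarrow> rat set" where
  "p_local_ring p = {of_int a / of_int b | a b. \<not> int p dvd b}"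

definition p_local_residue :: "nat \<Rightarrow> rat \<Rightarrow> int" where
  "p_local_residue p x = (THE r. r \<in> {0..<int p} \<and> x - of_int r \<in> p_local_ideal p)"

locale prime_localization =
  fixes p :: nat
  assumes p_prime: "prime p"
begin

abbreviation "Zp \<equiv> p_local_ring p"
abbreviation "I \<equiv> p_local_ideal p"
abbreviation "Fp \<equiv> residue_ring (int p)"
abbreviation "residue \<equiv> p_local_residue p"

sublocale Fp: residues_prime p Fp
  using p_prime by unfold_locales

lemma int_p_dvd_mult_iff: "int p dvd a * b \<longleftrightarrow> int p dvd a \<or> int p dvd b"
  using p_prime by (simp add: prime_dvd_mult_iff)

lemma not_int_p_dvd_1: "\<not> int p dvd 1"
  using p_prime by (auto dest: not_prime_unit)

lemma ZpI: "\<not> int p dvd b \<Longrightarrow> x = of_int a / of_int b \<Longrightarrow> x \<in> Zp"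
  unfolding p_local_ring_def by blast

lemma ZpE:
  assumes "x \<in> Zp"
  obtains a b where "\<not> int p dvd b" "b \<noteq> 0" "x = of_int a / of_int b"
  using assms unfolding p_local_ring_def by auto

lemma Zp_of_int [simp]: "of_int a \<in> Zp"
  using not_int_p_dvd_1 by (intro ZpI[of 1 _ a]) simp_all

lemma Ints_subset_Zp: "\<int> \<subseteq> Zp"
  by (auto elim: Ints_cases)

lemma Zp_add [simp]:
  assumes "x \<in> Zp" "y \<in> Zp"
  shows "x + y \<in> Zp"
proof -
  obtain a b c d where "\<not> int p dvd b" "b \<noteq> 0" "x = of_int a / of_int b"
    and "\<not> int p dvd d" "d \<noteq> 0" "y = of_int c / of_int d"
    using assms by (metis ZpE)
  then show ?thesis
    by (intro ZpI[of "b * d" _ "a * d + c * b"]) (simp_all add: int_p_dvd_mult_iff field_simps)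
qed

lemma Zp_mult [simp]:
  assumes "x \<in> Zp" "y \<in> Zp"
  shows "x * y \<in> Zp"
proof -
  obtain a b c d where "\<not> int p dvd b" "x = of_int a / of_int b"
    and "\<not> int p dvd d" "y = of_int c / of_int d"
    using assms by (metis ZpE)
  then show ?thesis
    by (intro ZpI[of "b * d" _ "a * c"]) (simp_all add: int_p_dvd_mult_iff)
qed

lemma Zp_uminus [simp]: "x \<in> Zp \<Longrightarrow> - x \<in> Zp"
  using Zp_mult[OF Zp_of_int[of "- 1"], of x] by simp

lemma Zp_subcring: "subcring Zp rat_ring"
proof -
  interpret cring rat_ring by (rule cring_from_type_algebra)
  show ?thesis
    using Zp_of_int[of 1] by (intro subcringI' subringI) simp_all
qed

lemma mem_ideal_iff: "x \<in> I \<longleftrightarrow> x / of_nat p \<in> Zp"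
proof
  assume "x \<in> I"
  then obtain a b where "\<not> int p dvd b" "x = of_int (int p * a) / of_int b"
    by (auto simp: p_local_ideal_def)
  then show "x / of_nat p \<in> Zp"
    using p_prime by (intro ZpI[of b _ a]) auto
next
  assume "x / of_nat p \<in> Zp"
  then obtain a b where "\<not> int p dvd b" "b \<noteq> 0" "x / of_nat p = of_int a / of_int b"
    by (rule ZpE)
  then have "\<not> int p dvd b \<and> x = of_int (int p * a) / of_int b"
    using p_prime by (simp add: field_simps)
  then show "x \<in> I"
    unfolding p_local_ideal_def by blast
qed

lemma ideal_add: "x \<in> I \<Longrightarrow> y \<in> I \<Longrightarrow> x + y \<in> I"
  by (simp add: mem_ideal_iff add_divide_distrib)

lemma ideal_mult: "x \<in> Zp \<Longrightarrow> y \<in> I \<Longrightarrow> x * y \<in> I"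
  using Zp_mult[of x "y / of_nat p"] by (simp add: mem_ideal_iff)

lemma ideal_diff: "x \<in> I \<Longrightarrow> y \<in> I \<Longrightarrow> x - y \<in> I"
  using Zp_add[of "x / of_nat p" "- (y / of_nat p)"]
  by (simp add: mem_ideal_iff diff_divide_distrib)

lemma of_int_mem_ideal_iff: "of_int a \<in> I \<longleftrightarrow> int p dvd a"
proof
  assume "of_int a \<in> I"
  then obtain c d where "\<not> int p dvd d" "d \<noteq> 0" "of_int a / of_nat p = (of_int c / of_int d :: rat)"
    unfolding mem_ideal_iff by (rule ZpE)
  moreover from this have "of_int (a * d) = (of_int (int p * c) :: rat)"
    using p_prime by (simp add: field_simps)
  then have "a * d = int p * c"
    by (simp only: of_int_eq_iff)
  then have "int p dvd a * d"
    by simp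
  ultimately show "int p dvd a"
    by (simp add: int_p_dvd_mult_iff)
next
  assume "int p dvd a"
  then obtain k where "a = int p * k" ..
  then show "of_int a \<in> I"
    using p_prime by (simp add: mem_ideal_iff)
qed

lemma ideal_subset: "I \<subseteq> Zp"
proof
  fix x assume "x \<in> I"
  then have "of_int (int p) * (x / of_nat p) \<in> Zp"
    using Zp_of_int by (intro Zp_mult) (simp_all only: mem_ideal_iff)
  then show "x \<in> Zp"
    using p_prime by simp
qed

lemma Zp_inverse:
  assumes "x \<in> Zp" "x \<notin> I"
  shows "inverse x \<in> Zp"
proof -
  obtain a b where ab: "\<not> int p dvd b" "b \<noteq> 0" "x = of_int a / of_int b"
    using assms(1) by (rule ZpE)
  then have "x = of_int 1 / of_int b * of_int a"
    by simp
  then have "\<not> int p dvd a"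
    using assms(2) ideal_mult[OF ZpI[OF ab(1) refl], of "of_int a"] of_int_mem_ideal_iff by metis
  then show ?thesis
    using ab by (intro ZpI[of a _ b]) simp_all
qed

lemma residue_eqI:
  assumes "x - of_int a \<in> I"
  shows "residue x = a mod int p"
  unfolding p_local_residue_def
proof (rule the_equality)
  have "of_int (a - a mod int p) \<in> I"
    unfolding of_int_mem_ideal_iff by (simp add: dvd_minus_mod)
  from ideal_add[OF assms this]
  show "a mod int p \<in> {0..<int p} \<and> x - of_int (a mod int p) \<in> I"
    using p_prime by (simp add: prime_gt_0_nat)
  fix r assume r: "r \<in> {0..<int p} \<and> x - of_int r \<in> I"
  then have "of_int (r - a) \<in> I"
    using ideal_diff[OF assms, of "x - of_int r"] by simp
  then have "r mod int p = a mod int p"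
    by (simp only: of_int_mem_ideal_iff mod_eq_dvd_iff)
  then show "r = a mod int p"
    using r by simp
qed

lemma residue_of_int: "residue (of_int a) = a mod int p"
  by (rule residue_eqI) (use of_int_mem_ideal_iff[of 0] in simp)

lemma residue_exists:
  assumes "x \<in> Zp"
  obtains a where "x - of_int a \<in> I"
proof -
  obtain a b where ab: "\<not> int p dvd b" "b \<noteq> 0" "x = of_int a / of_int b"
    using assms by (rule ZpE)
  then obtain c where "[b * c = 1] (mod int p)"
    using cong_solve_coprime_int Fp.p_coprime_right_int by blast
  then have "of_int (a * (1 - b * c)) \<in> I"
    unfolding of_int_mem_ideal_iff by (simp add: cong_iff_dvd_diff dvd_diff_commute)
  then have "of_int 1 / of_int b * of_int (a * (1 - b * c)) \<in> I"
    by (intro ideal_mult ZpI[OF ab(1) refl])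
  also have "of_int 1 / of_int b * of_int (a * (1 - b * c)) = x - of_int (a * c)"
    using ab by (simp add: field_simps)
  finally show ?thesis
    by (rule that)
qed

lemma residue_diff_mem: "x \<in> Zp \<Longrightarrow> x - of_int (residue x) \<in> I"
proof -
  assume "x \<in> Zp"
  then obtain a where a: "x - of_int a \<in> I"
    by (rule residue_exists)
  have "of_int (a - a mod int p) \<in> I"
    by (simp only: of_int_mem_ideal_iff dvd_minus_mod)
  from ideal_add[OF a this] show ?thesis
    by (simp add: residue_eqI[OF a])
qed

lemma residue_ring_hom: "residue \<in> ring_hom (rat_ring\<lparr>carrier := Zp\<rparr>) Fp"
proof (rule ring_hom_memI)
  show "residue x \<in> carrier Fp" if "x \<in> carrier (rat_ring\<lparr>carrier := Zp\<rparr>)" for x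
  proof -
    obtain a where "x - of_int a \<in> I"
      using residue_exists[of x] \<open>x \<in> carrier (rat_ring\<lparr>carrier := Zp\<rparr>)\<close> by auto
    then show ?thesis
      by (simp add: residue_eqI Fp.mod_in_carrier)
  qed
  show "residue \<one>\<^bsub>rat_ring\<lparr>carrier := Zp\<rparr>\<^esub> = \<one>\<^bsub>Fp\<^esub>"
    using residue_of_int[of 1] Fp.m_gt_one by (simp add: Fp.res_one_eq)
  fix x y assume "x \<in> carrier (rat_ring\<lparr>carrier := Zp\<rparr>)" "y \<in> carrier (rat_ring\<lparr>carrier := Zp\<rparr>)"
  then have x: "x \<in> Zp" and y: "y \<in> Zp"
    by simp_all
  note diff = residue_diff_mem[OF x] residue_diff_mem[OF y]
  have "x + y - of_int (residue x + residue y) \<in> I"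
    using ideal_add[OF diff] by (simp add: algebra_simps)
  then show "residue (x \<oplus>\<^bsub>rat_ring\<lparr>carrier := Zp\<rparr>\<^esub> y) = residue x \<oplus>\<^bsub>Fp\<^esub> residue y"
    by (simp add: Fp.res_add_eq residue_eqI)
  have "x * (y - of_int (residue y)) + of_int (residue y) * (x - of_int (residue x)) \<in> I"
    using x diff by (intro ideal_add ideal_mult) simp_all
  then have "x * y - of_int (residue x * residue y) \<in> I"
    by (simp add: algebra_simps)
  then show "residue (x \<otimes>\<^bsub>rat_ring\<lparr>carrier := Zp\<rparr>\<^esub> y) = residue x \<otimes>\<^bsub>Fp\<^esub> residue y"
    by (simp add: Fp.res_mult_eq residue_eqI)
qed

lemma residue_surj: "residue ` Zp = carrier Fp"
proof (intro equalityI subsetI)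
  fix a assume "a \<in> carrier Fp"
  then have "residue (of_int a) = a"
    by (simp add: residue_of_int Fp.res_carrier_eq)
  then show "a \<in> residue ` Zp"
    using Zp_of_int by (metis image_eqI)
qed (use ring_hom_closed[OF residue_ring_hom] in auto)

lemma ideal_eq: "I = {x \<in> Zp. residue x = 0}"
  using ideal_subset residue_diff_mem residue_eqI[of _ 0] by fastforce

lemma Zp_unit:
  assumes "x \<in> Zp" "residue x \<noteq> 0"
  shows "x \<in> Units (rat_ring\<lparr>carrier := Zp\<rparr>)"
proof -
  have "inverse x \<in> Zp" "x \<noteq> 0"
    using assms Zp_inverse[of x] residue_of_int[of 0] by (auto simp: ideal_eq)
  with assms(1) show ?thesis
    by (auto simp: Units_def intro!: bexI[of _ "inverse x"])
qed

end

section \<open>Laxton's group\<close>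

locale laxton = prime_localization p for p +
  fixes P Q :: int
  assumes Q_not_dvd: "\<not> int p dvd Q"

sublocale laxton \<subseteq> local_reduction rat_ring "of_int P" "of_int Q" "residue_ring (int p)"
  "P mod int p" "Q mod int p" "p_local_ring p" "p_local_residue p"
proof (intro local_reduction.intro local_reduction_axioms.intro)
  show "Q mod int p \<noteq> \<zero>\<^bsub>Fp\<^esub>"
    using Q_not_dvd by (auto simp: Fp.res_zero_eq)
  show "x \<in> Units (rat_ring\<lparr>carrier := Zp\<rparr>)" if "x \<in> Zp" "residue x \<noteq> \<zero>\<^bsub>Fp\<^esub>" for x
    using that by (intro Zp_unit) (simp_all add: Fp.res_zero_eq)
qed (intro cring_from_type_algebra Fp.is_field Zp_subcring residue_ring_hom residue_surj Zp_of_int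
    residue_of_int)+

context laxton
begin

subsection \<open>Representatives with coprime integral initial terms\<close>

lemma coprime_init_exists:
  assumes w: "w \<in> carrier K.SG"
  obtains v a b where "v \<in> carrier K.SG" "K.scale_class v = K.scale_class w" "coprime_init v a b"
proof -
  have "w 1 \<noteq> 0 \<or> w 0 \<noteq> 0"
    using w by (auto simp: K.carrier_seq_group type_algebra_Lam)
  then obtain c a b where c: "c \<noteq> 0" "c * w 1 = of_int a" "c * w 0 = of_int b" "coprime a b"
    by (rule rat_pair_coprime)
  let ?v = "\<lambda>n. c * w n"
  have v: "?v \<in> carrier K.SG"
    using K.carrier_scale_shift[OF w, of c 0] c(1) by simp
  moreover have "K.scale_class ?v = K.scale_class w"
    using K.scale_class_eq_iff[OF v w] c(1) by auto
  moreover have "coprime_init ?v a b"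
    using c by (simp add: coprime_init_def)
  ultimately show ?thesis
    by (rule that)
qed

lemma coprime_init_primitive:
  assumes w: "w \<in> carrier K.SG" "coprime_init w a b"
  shows "primitive w" "residue (w 1) = a mod int p" "residue (w 0) = b mod int p"
proof -
  have ab: "w 1 = of_int a" "w 0 = of_int b" "coprime a b"
    using w(2) by (auto simp: coprime_init_def)
  show residues: "residue (w 1) = a mod int p" "residue (w 0) = b mod int p"
    by (simp_all add: ab residue_of_int)
  have "\<not> (int p dvd a \<and> int p dvd b)"
    using ab(3) p_prime not_coprimeI not_prime_unit by (metis prime_nat_int_transfer)
  then have "\<exists>n. residue (w n) \<noteq> 0"
    using residues by (metis dvd_eq_mod_eq_0)
  moreover have "w \<in> \<O>.seqs"
    using ab by (intro local_seqsI K.carrier_seqs[OF w(1)]) simp_all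
  ultimately show "primitive w"
    by (simp add: primitive_def Fp.res_zero_eq)
qed

lemma coprime_init_Gs_class:
  assumes w: "w \<in> carrier K.SG" "coprime_init w a b"
  shows "Gs_class Fp (P mod int p) (Q mod int p) (a mod int p) (b mod int p) =
    F.shift_class (residue \<circ> w)"
proof -
  note primitive = coprime_init_primitive[OF w]
  have "init_seq Fp (P mod int p) (Q mod int p) (a mod int p) (b mod int p) = residue \<circ> w"
    using primitive(2,3)
    by (intro F.init_seq_eqI reduction_seq primitive_seqs primitive(1)) simp_all
  then show ?thesis
    by (simp add: Gs_class_def F.shift_class_def)
qed

lemma coprime_init_shift_class:
  assumes s: "s \<in> carrier \<O>.SG" and w: "w \<in> K.shift_class s" "coprime_init w a b"
  shows "Gs_class Fp (P mod int p) (Q mod int p) (a mod int p) (b mod int p) =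
    F.shift_class (residue \<circ> s)"
proof -
  have "w \<in> carrier K.SG" "K.shift_class w = K.shift_class s"
    using w(1) K.mem_shift_class_iff[OF subsetD[OF local_group_subset s]] by auto
  then show ?thesis
    using primitive_shift_class_local(2)[OF s] coprime_init_primitive(1) coprime_init_Gs_class w(2)
    by metis
qed

lemma coprime_init_mem_shift_class:
  assumes w: "w \<in> carrier K.SG"
  shows "\<exists>v\<in>K.shift_class w. \<exists>a b. coprime_init v a b"
proof -
  obtain v a b where v: "v \<in> carrier K.SG" "K.scale_class v = K.scale_class w" "coprime_init v a b"
    using w by (rule coprime_init_exists)
  have "v \<in> K.shift_class w"
    using K.mem_shift_class_iff[OF w] K.scale_class_imp_shift_class[OF v(1) w v(2)] v(1) by simp
  with v(3) show ?thesis
    by blast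
qed

lemma red_Gs_shift_class:
  assumes s: "s \<in> carrier \<O>.SG"
  shows "red_Gs P Q p (K.shift_class s) = F.shift_class (residue \<circ> s)"
  unfolding red_Gs_def
proof (rule the_equality)
  show "\<exists>w\<in>K.shift_class s. \<exists>a b. coprime_init w a b \<and> F.shift_class (residue \<circ> s) =
      Gs_class Fp (P mod int p) (Q mod int p) (a mod int p) (b mod int p)"
    using coprime_init_mem_shift_class[OF subsetD[OF local_group_subset s]]
      coprime_init_shift_class[OF s] by metis
qed (use coprime_init_shift_class[OF s] in metis)

subsection \<open>The subgroups defined by reduction\<close>

lemma carrier_G_grp_primitive:
  "carrier (GQ P Q) = K.scale_class ` {w \<in> carrier K.SG. primitive w}"
proof (intro equalityI subsetI)
  fix x assume "x \<in> carrier (GQ P Q)"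
  then obtain w where w: "w \<in> carrier K.SG" "x = K.scale_class w"
    by (auto simp: K.carrier_G_grp)
  obtain v a b where "v \<in> carrier K.SG" "K.scale_class v = K.scale_class w" "coprime_init v a b"
    using w(1) by (rule coprime_init_exists)
  then show "x \<in> K.scale_class ` {w \<in> carrier K.SG. primitive w}"
    using coprime_init_primitive(1) w(2) by blast
qed (auto simp: K.carrier_G_grp)

lemma red_proj_primitive:
  assumes w: "primitive w" "w \<in> carrier K.SG"
  shows "red_proj p (K.scale_class w) = proj_pt Fp (residue (w 1)) (residue (w 0))"
proof -
  have point: "proj_pt Fp (a mod int p) (b mod int p) = proj_pt Fp (residue (w 1)) (residue (w 0))"
    if v: "v \<in> K.scale_class w" "coprime_init v a b" for v a b
  proof -
    have "v \<in> carrier K.SG" "K.scale_class v = K.scale_class w"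
      using v(1) K.mem_scale_class_iff[OF w(2)] by auto
    then show ?thesis
      using primitive_scale_class_proj_pt[OF w] coprime_init_primitive[OF _ v(2)] by metis
  qed
  obtain v a b where "v \<in> carrier K.SG" "K.scale_class v = K.scale_class w" "coprime_init v a b"
    using w(2) by (rule coprime_init_exists)
  then have "v \<in> K.scale_class w"
    using K.mem_scale_class_iff[OF w(2)] by simp
  then show ?thesis
    unfolding red_proj_def
    using \<open>coprime_init v a b\<close> point by (intro the_equality) metis+
qed

lemma eq_scale_class_imageI:
  assumes "Y \<subseteq> carrier (GQ P Q)" "S \<subseteq> carrier \<O>.SG"
    and iff: "\<And>w. primitive w \<Longrightarrow> w \<in> carrier K.SG \<Longrightarrow> K.scale_class w \<in> Y \<longleftrightarrow> w \<in> S"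
  shows "Y = K.scale_class ` S"
proof (intro equalityI subsetI)
  fix y assume y: "y \<in> Y"
  then obtain w where "primitive w" "w \<in> carrier K.SG" "y = K.scale_class w"
    using assms(1) unfolding carrier_G_grp_primitive by blast
  then show "y \<in> K.scale_class ` S"
    using iff y by blast
next
  fix y assume "y \<in> K.scale_class ` S"
  then obtain w where "w \<in> S" "y = K.scale_class w" ..
  then show "y \<in> Y"
    using iff assms(2) local_group_primitive local_group_subset by blast
qed

lemma G_p_eq: "G_p P Q p = K.scale_class ` reduction_kernel"
proof (rule eq_scale_class_imageI[OF _ reduction_kernel_subset])
  fix w assume w: "primitive w" "w \<in> carrier K.SG"
  then show "K.scale_class w \<in> G_p P Q p \<longleftrightarrow> w \<in> reduction_kernel"
    using primitive_proj_pt_one_iff[OF w]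
    by (simp add: G_p_def red_proj_primitive Fp.res_one_eq Fp.res_zero_eq)
qed (auto simp: G_p_def)

lemma K_p_eq: "K_p P Q p = K.scale_class ` carrier \<O>.SG"
proof (rule eq_scale_class_imageI[OF _ subset_refl])
  fix w assume w: "primitive w" "w \<in> carrier K.SG"
  have "to_proj ` carrier (GF P Q p) = (\<lambda>u. proj_pt Fp (u 1) (u 0)) ` carrier F.SG"
    by (simp add: F.carrier_G_grp image_image F.to_proj_scale_class)
  then show "K.scale_class w \<in> K_p P Q p \<longleftrightarrow> w \<in> carrier \<O>.SG"
    using w primitive_proj_pt_iff[OF w] by (simp add: K_p_def red_proj_primitive image_iff)
qed (auto simp: K_p_def)

lemma H_p_eq: "H_p P Q p = isolator (GQ P Q) (G_p P Q p)"
  unfolding H_p_def G_p_def isolator_def using K.G.int_pow_closed by blast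

lemma to_GsQ_eq: "to_GsQ P Q = K.scale_to_shift"
  by (simp add: to_GsQ_def fun_eq_iff)

lemma Gs_p_eq: "Gs_p P Q p = Gs_kernel"
  unfolding Gs_p_def G_p_eq to_GsQ_eq
  by (rule K.scale_to_shift_image[OF subgroup.subset[OF reduction_kernel_subgroup]])

lemma Ks_p_eq: "Ks_p P Q p = Gs_local"
  unfolding Ks_p_def K_p_eq to_GsQ_eq by (rule K.scale_to_shift_image[OF local_group_subset])

lemma Hs_p_eq: "Hs_p P Q p = isolator (GsQ P Q) Gs_kernel"
  unfolding Hs_p_def H_p_eq G_p_eq to_GsQ_eq by (rule isolator_scale_to_shift[OF Fp.finite])

lemma Gs_p_subgroup: "subgroup (Gs_p P Q p) (GsQ P Q)"
  unfolding Gs_p_eq by (rule Gs_kernel_subgroup)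

lemma Ks_p_subgroup: "subgroup (Ks_p P Q p) (GsQ P Q)"
  unfolding Ks_p_eq by (rule Gs_local_subgroup)

lemma Hs_p_subgroup: "subgroup (Hs_p P Q p) (GsQ P Q)"
  unfolding Hs_p_eq by (rule K.Gs.isolator_subgroup[OF Gs_kernel_subgroup])

lemma Ks_p_coprime_init:
  assumes "W \<in> Ks_p P Q p"
  shows "\<exists>w\<in>W. \<exists>a b. coprime_init w a b"
  using assms coprime_init_mem_shift_class local_group_subset unfolding Ks_p_eq by blast

lemma red_Gs_coprime_init:
  assumes "W \<in> Ks_p P Q p" "w \<in> W" "coprime_init w a b"
  shows "red_Gs P Q p W = Gs_class Fp (P mod int p) (Q mod int p) (a mod int p) (b mod int p)"
proof -
  obtain s where "s \<in> carrier \<O>.SG" "W = K.shift_class s"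
    using assms(1) unfolding Ks_p_eq by blast
  then show ?thesis
    using coprime_init_shift_class red_Gs_shift_class assms(2,3) by metis
qed

lemma short_exact_red_Gs:
  "short_exact (GsQ P Q\<lparr>carrier := Gs_p P Q p\<rparr>) (\<lambda>W. W)
    (GsQ P Q\<lparr>carrier := Ks_p P Q p\<rparr>) (red_Gs P Q p) (GsF P Q p)"
  unfolding Gs_p_eq Ks_p_eq by (rule short_exact_reduction[OF red_Gs_shift_class])

subsection \<open>Eventually integral sequences\<close>

abbreviation "L \<equiv> laxton_seqs P Q"
abbreviation "LG \<equiv> laxton_group P Q"
abbreviation "laxton_class w \<equiv> shift_rel rat_ring L `` {w}"

lemma rec_Ints:
  assumes w: "w \<in> K.seqs" "w m \<in> \<int>" "w (m + 1) \<in> \<int>" and "m \<le> k"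
  shows "w k \<in> \<int>"
proof -
  have "w (m + int n) \<in> \<int> \<and> w (m + int n + 1) \<in> \<int>" for n
  proof (induction n)
    case (Suc n)
    then show ?case
      using K.rec_step[OF w(1), of "m + int n"] by (simp add: ac_simps)
  qed (use w in simp)
  from this[of "nat (k - m)"] show ?thesis
    using \<open>m \<le> k\<close> by simp
qed

lemma laxton_seqs_iff:
  "w \<in> L \<longleftrightarrow> w \<in> carrier K.SG \<and> (\<exists>m. w m \<in> \<int> \<and> w (m + 1) \<in> \<int>)"
proof
  assume "w \<in> L"
  then obtain m where "w \<in> carrier K.SG" "\<forall>k\<ge>m. w k \<in> \<int>"
    by (auto simp: laxton_seqs_def K.carrier_seq_group)
  then show "w \<in> carrier K.SG \<and> (\<exists>m. w m \<in> \<int> \<and> w (m + 1) \<in> \<int>)"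
    by (auto intro!: exI[of _ m])
next
  assume w: "w \<in> carrier K.SG \<and> (\<exists>m. w m \<in> \<int> \<and> w (m + 1) \<in> \<int>)"
  then have "\<exists>m. \<forall>k\<ge>m. w k \<in> \<int>"
    using rec_Ints K.carrier_seqs by blast
  with w show "w \<in> L"
    by (auto simp: laxton_seqs_def K.carrier_seq_group)
qed

lemma laxton_seqs_carrier: "L \<subseteq> carrier K.SG"
  by (auto simp: laxton_seqs_iff)

lemma laxton_seqs_submonoid: "submonoid L K.SG"
proof (rule submonoid.intro)
  show "\<one>\<^bsub>K.SG\<^esub> \<in> L"
    using K.one_seq(2,3) by (auto simp: laxton_seqs_iff intro!: exI[of _ 0])
  fix w v assume wv: "w \<in> L" "v \<in> L"
  then obtain m k where Ints: "w m \<in> \<int>" "w (m + 1) \<in> \<int>" "v k \<in> \<int>" "v (k + 1) \<in> \<int>"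
    by (auto simp: laxton_seqs_iff)
  let ?w = "\<lambda>n. w (n + m)" and ?v = "\<lambda>n. v (n + k)"
  have seqs: "w \<in> K.seqs" "v \<in> K.seqs"
    using wv laxton_seqs_carrier K.carrier_seqs by blast+
  note shifted = K.rec_seqs_shift[OF seqs(1), of m] K.rec_seqs_shift[OF seqs(2), of k]
  have "(?w \<otimes>\<^bsub>K.SG\<^esub> ?v) 0 \<in> \<int>" "(?w \<otimes>\<^bsub>K.SG\<^esub> ?v) 1 \<in> \<int>"
    unfolding K.mult_0[OF shifted] K.mult_1[OF shifted] using Ints by (simp_all add: add.commute)
  then have "(w \<otimes>\<^bsub>K.SG\<^esub> v) (m + k) \<in> \<int>" "(w \<otimes>\<^bsub>K.SG\<^esub> v) (m + k + 1) \<in> \<int>"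
    by (simp_all add: K.mult_shift[OF seqs] add.commute)
  moreover have "w \<otimes>\<^bsub>K.SG\<^esub> v \<in> carrier K.SG"
    using wv laxton_seqs_carrier by (intro K.SG.m_closed) auto
  ultimately show "w \<otimes>\<^bsub>K.SG\<^esub> v \<in> L"
    by (auto simp: laxton_seqs_iff)
qed (rule laxton_seqs_carrier)

sublocale laxton: subcongruence K.SG "shift_rel rat_ring (carrier K.SG)" L "shift_rel rat_ring L"
proof (intro subcongruence.intro subcongruence_axioms.intro laxton_seqs_submonoid
    K.shift.monoid_congruence_axioms)
  show "monoid_congruence (K.SG\<lparr>carrier := L\<rparr>) (shift_rel rat_ring L)"
    unfolding shift_rel_eq
    by (rule K.scale_shift_congruence[OF _ laxton_seqs_submonoid])
      (rule group.subgroup_self[OF group_integer_group, simplified])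
  show "shift_rel rat_ring L \<subseteq> shift_rel rat_ring (carrier K.SG)"
    using laxton_seqs_carrier by (auto simp: shift_rel_def)
qed

lemma carrier_laxton_group: "carrier LG = laxton_class ` L"
  using laxton.small.carrier_quot_monoid by (simp add: laxton_group_def)

lemma to_GsQ_laxton_class: "w \<in> L \<Longrightarrow> to_GsQ P Q (laxton_class w) = K.shift_class w"
  unfolding to_GsQ_eq K.shift_class_def by (rule laxton.Image_class)

lemma mem_laxton_class_iff:
  assumes w: "w \<in> L"
  shows "v \<in> laxton_class w \<longleftrightarrow> v \<in> L \<and> K.shift_class v = K.shift_class w"
proof -
  have "v \<in> laxton_class w \<longleftrightarrow> v \<in> L \<and> v \<in> K.shift_class w"
    using w laxton_seqs_carrier by (auto simp: K.shift_class_def shift_rel_def)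
  then show ?thesis
    using K.mem_shift_class_iff[of w v] w laxton_seqs_carrier by blast
qed

lemma laxton_coprime_init_exists:
  assumes w: "w \<in> carrier K.SG"
  obtains v a b where "v \<in> L" "K.shift_class v = K.shift_class w" "coprime_init v a b"
proof -
  obtain v a b where v: "v \<in> carrier K.SG" "K.scale_class v = K.scale_class w" "coprime_init v a b"
    using w by (rule coprime_init_exists)
  moreover have "v \<in> L"
    using v(1,3) by (auto simp: laxton_seqs_iff coprime_init_def intro!: exI[of _ 0])
  ultimately show ?thesis
    using that K.scale_class_imp_shift_class[OF v(1) w] by blast
qed

lemma to_GsQ_iso: "to_GsQ P Q \<in> iso LG (GsQ P Q)"
proof -
  have "\<exists>v\<in>L. (w, v) \<in> shift_rel rat_ring (carrier K.SG)" if w: "w \<in> carrier K.SG" for w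
  proof -
    obtain v a b where v: "v \<in> L" "K.shift_class v = K.shift_class w" "coprime_init v a b"
      using w by (rule laxton_coprime_init_exists)
    then have "(w, v) \<in> shift_rel rat_ring (carrier K.SG)"
      using w laxton_seqs_carrier K.shift.class_eq_iff[of w v] unfolding K.shift_class_def by auto
    with v(1) show ?thesis
      by blast
  qed
  moreover have "Restr (shift_rel rat_ring (carrier K.SG)) L \<subseteq> shift_rel rat_ring L"
    by (auto simp: shift_rel_def)
  ultimately show ?thesis
    unfolding to_GsQ_eq laxton_group_def Gs_grp_def by (intro laxton.Image_iso)
qed

lemma laxton_group_comm_group: "comm_group LG"
proof (rule comm_group_iso_vimage[OF _ K.Gs.comm_group_axioms to_GsQ_iso])
  show "monoid LG"
    unfolding laxton_group_def by (rule laxton.small.monoid_quot_monoid)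
qed

subsection \<open>Laxton's subgroups\<close>

lemma to_GsQ_image_eqI:
  assumes "Y \<subseteq> carrier LG" "Z \<subseteq> carrier (GsQ P Q)"
    and iff: "\<And>w. w \<in> L \<Longrightarrow> laxton_class w \<in> Y \<longleftrightarrow> K.shift_class w \<in> Z"
  shows "to_GsQ P Q ` Y = Z"
proof (intro equalityI subsetI)
  fix z assume "z \<in> to_GsQ P Q ` Y"
  then obtain w where "w \<in> L" "laxton_class w \<in> Y" "z = to_GsQ P Q (laxton_class w)"
    using assms(1) unfolding carrier_laxton_group by blast
  then show "z \<in> Z"
    using iff by (simp only: to_GsQ_laxton_class)
next
  fix z assume z: "z \<in> Z"
  then obtain w where w: "w \<in> carrier K.SG" "z = K.shift_class w"
    using assms(2) unfolding K.carrier_Gs_grp by blast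
  obtain v a b where v: "v \<in> L" "K.shift_class v = K.shift_class w" "coprime_init v a b"
    using w(1) by (rule laxton_coprime_init_exists)
  then have "laxton_class v \<in> Y" "z = to_GsQ P Q (laxton_class v)"
    using iff z w(2) by (simp_all only: to_GsQ_laxton_class)
  then show "z \<in> to_GsQ P Q ` Y"
    by (rule rev_image_eqI)
qed

lemma seq_dvd_iff: "seq_dvd p w \<longleftrightarrow> (\<exists>n. w n \<in> Zp \<and> residue (w n) = \<zero>\<^bsub>Fp\<^esub>)"
  by (simp add: seq_dvd_def ideal_eq Fp.res_zero_eq)

lemma laxton_G_iff:
  assumes w: "w \<in> L"
  shows "laxton_class w \<in> laxton_G P Q p \<longleftrightarrow> K.shift_class w \<in> Gs_kernel"
proof -
  obtain u a b where u: "u \<in> L" "K.shift_class u = K.shift_class w" "coprime_init u a b"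
    using w laxton_seqs_carrier by (meson laxton_coprime_init_exists subsetD)
  have uK: "u \<in> carrier K.SG"
    using u(1) laxton_seqs_carrier by blast
  then have primitive: "primitive u"
    using u(3) by (rule coprime_init_primitive)
  have "(\<forall>v\<in>laxton_class w. seq_dvd p v) \<longleftrightarrow> seq_dvd p u"
  proof (intro iffI ballI)
    assume "\<forall>v\<in>laxton_class w. seq_dvd p v"
    then show "seq_dvd p u"
      using u(1,2) mem_laxton_class_iff[OF w] by blast
  next
    fix v assume "seq_dvd p u" "v \<in> laxton_class w"
    then obtain i where i: "residue (u i) = \<zero>\<^bsub>Fp\<^esub>" and v: "v \<in> L" "K.shift_class v = K.shift_class u"
      using u(2) mem_laxton_class_iff[OF w] by (auto simp: seq_dvd_iff)
    then obtain k where "\<And>n. k \<le> n \<Longrightarrow> v n \<in> Zp"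
      using Ints_subset_Zp by (auto simp: laxton_seqs_def)
    then show "seq_dvd p v"
      using eventually_local_zero[OF _ _ primitive uK i v(2)] v(1) laxton_seqs_carrier
      unfolding seq_dvd_iff by blast
  qed
  also have "\<dots> \<longleftrightarrow> K.shift_class u \<in> Gs_kernel"
    using primitive_mem[OF primitive]
    by (simp add: primitive_mem_Gs_kernel_iff[OF primitive uK] seq_dvd_iff)
  finally show ?thesis
    using w by (simp add: laxton_G_def carrier_laxton_group u(2))
qed

lemma local_group_of_int_iff:
  assumes w: "w \<in> carrier K.SG" "w 1 = of_int a" "w 0 = of_int b"
  shows "w \<in> carrier \<O>.SG \<longleftrightarrow> \<not> int p dvd a\<^sup>2 - P * b * a + Q * b\<^sup>2"
proof -
  let ?N = "a\<^sup>2 - P * b * a + Q * b\<^sup>2"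
  have "w \<in> \<O>.seqs"
    using w by (intro local_seqsI K.carrier_seqs) simp_all
  moreover have "\<O>.\<Lambda> (w 1) (w 0) = of_int ?N"
    using incl.hom_Lam[of "w 1" "w 0"] w(2,3) by (simp add: type_algebra_Lam)
  moreover have "residue (of_int ?N) = \<zero>\<^bsub>Fp\<^esub> \<longleftrightarrow> int p dvd ?N"
    by (simp only: residue_of_int Fp.res_zero_eq dvd_eq_mod_eq_0)
  ultimately show ?thesis
    using local_unit_iff[OF Zp_of_int[of ?N]]
    by (simp only: \<O>.carrier_seq_group not_False_eq_True simp_thms)
qed

lemma laxton_K_iff:
  assumes w: "w \<in> L"
  shows "laxton_class w \<in> laxton_K P Q p \<longleftrightarrow> K.shift_class w \<in> Gs_local"
proof
  assume "laxton_class w \<in> laxton_K P Q p"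
  then obtain v a b where v: "v \<in> laxton_class w" "v 1 = of_int a" "v 0 = of_int b"
    "\<not> int p dvd a\<^sup>2 - P * b * a + Q * b\<^sup>2"
    by (auto simp: laxton_K_def)
  then have "v \<in> carrier K.SG" "K.shift_class v = K.shift_class w"
    using mem_laxton_class_iff[OF w] laxton_seqs_carrier by blast+
  then show "K.shift_class w \<in> Gs_local"
    using local_group_of_int_iff v(2-4) by (metis imageI)
next
  assume local: "K.shift_class w \<in> Gs_local"
  obtain v a b where v: "v \<in> L" "K.shift_class v = K.shift_class w" "coprime_init v a b"
    using w laxton_seqs_carrier by (meson laxton_coprime_init_exists subsetD)
  have vK: "v \<in> carrier K.SG"
    using v(1) laxton_seqs_carrier by blast
  have ab: "v 1 = of_int a" "v 0 = of_int b"
    using v(3) by (simp_all add: coprime_init_def)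
  have "v \<in> carrier \<O>.SG"
    using local primitive_mem_Gs_local_iff[OF coprime_init_primitive(1)[OF vK v(3)] vK] v(2)
    by simp
  then have "\<not> int p dvd a\<^sup>2 - P * b * a + Q * b\<^sup>2"
    using local_group_of_int_iff[OF vK ab] by blast
  moreover have "v \<in> laxton_class w"
    using v(1,2) mem_laxton_class_iff[OF w] by simp
  ultimately show "laxton_class w \<in> laxton_K P Q p"
    using w ab unfolding laxton_K_def carrier_laxton_group by blast
qed

lemma laxton_G_subset: "laxton_G P Q p \<subseteq> carrier LG"
  by (auto simp: laxton_G_def)

lemma laxton_K_subset: "laxton_K P Q p \<subseteq> carrier LG"
  by (auto simp: laxton_K_def)

lemma laxton_G_image: "to_GsQ P Q ` laxton_G P Q p = Gs_p P Q p"
  unfolding Gs_p_eq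
  by (intro to_GsQ_image_eqI laxton_G_subset laxton_G_iff subgroup.subset[OF Gs_kernel_subgroup])

lemma laxton_K_image: "to_GsQ P Q ` laxton_K P Q p = Ks_p P Q p"
  unfolding Ks_p_eq
  by (intro to_GsQ_image_eqI laxton_K_subset laxton_K_iff subgroup.subset[OF Gs_local_subgroup])

lemma laxton_G_subgroup: "subgroup (laxton_G P Q p) LG"
  using Gs_p_subgroup unfolding laxton_G_image[symmetric]
  by (rule subgroup_iso_vimage[OF comm_group.axioms(2)[OF laxton_group_comm_group]
      K.Gs.group_axioms to_GsQ_iso laxton_G_subset])

lemma laxton_K_subgroup: "subgroup (laxton_K P Q p) LG"
  using Ks_p_subgroup unfolding laxton_K_image[symmetric]
  by (rule subgroup_iso_vimage[OF comm_group.axioms(2)[OF laxton_group_comm_group]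
      K.Gs.group_axioms to_GsQ_iso laxton_K_subset])

lemma laxton_H_eq: "laxton_H P Q p = isolator LG (laxton_G P Q p)"
  by (simp add: laxton_H_def isolator_def)

lemma laxton_H_subgroup: "subgroup (laxton_H P Q p) LG"
  unfolding laxton_H_eq
  by (rule comm_group.isolator_subgroup[OF laxton_group_comm_group laxton_G_subgroup])

lemma laxton_H_image: "to_GsQ P Q ` laxton_H P Q p = Hs_p P Q p"
proof -
  interpret LG: comm_group LG by (rule laxton_group_comm_group)
  interpret iso: group_hom LG "GsQ P Q" "to_GsQ P Q"
    using to_GsQ_iso by unfold_locales (simp add: iso_def)
  have bij: "inj_on (to_GsQ P Q) (carrier LG)" "to_GsQ P Q ` carrier LG = carrier (GsQ P Q)"
    using to_GsQ_iso by (simp_all add: iso_def bij_betw_def)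
  have "kernel LG (GsQ P Q) (to_GsQ P Q) = {\<one>\<^bsub>LG\<^esub>}"
    using iso.inj_iff_trivial_ker bij(1) by simp
  then have "kernel LG (GsQ P Q) (to_GsQ P Q) \<subseteq> isolator LG (laxton_G P Q p)"
    using subgroup.one_closed[OF laxton_H_subgroup] by (simp add: laxton_H_eq)
  then show ?thesis
    using iso.isolator_image[OF laxton_group_comm_group bij(2) laxton_G_subgroup]
    by (simp add: laxton_H_eq Hs_p_eq laxton_G_image Gs_p_eq)
qed

end

theorem theorem7:
  fixes P Q :: int and p :: nat
  assumes "Q \<noteq> 0" and "P^2 - 4 * Q \<noteq> 0"
    and "prime p" and "\<not> int p dvd Q"
  shows "(group (laxton_group P Q) \<and> group (GsQ P Q) \<and>
      to_GsQ P Q \<in> iso (laxton_group P Q) (GsQ P Q)) \<and>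
    (subgroup (laxton_G P Q p) (laxton_group P Q) \<and>
      subgroup (laxton_K P Q p) (laxton_group P Q) \<and>
      subgroup (laxton_H P Q p) (laxton_group P Q)) \<and>
    (subgroup (Gs_p P Q p) (GsQ P Q) \<and>
      subgroup (Ks_p P Q p) (GsQ P Q) \<and>
      subgroup (Hs_p P Q p) (GsQ P Q)) \<and>
    (to_GsQ P Q ` laxton_G P Q p = Gs_p P Q p) \<and>
    (to_GsQ P Q ` laxton_K P Q p = Ks_p P Q p) \<and>
    (to_GsQ P Q ` laxton_H P Q p = Hs_p P Q p) \<and>
    (\<forall>W \<in> Ks_p P Q p.
      (\<exists>w\<in>W. \<exists>a b. coprime_init w a b) \<and>
      (\<forall>w\<in>W. \<forall>a b. coprime_init w a b \<longrightarrow>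
        red_Gs P Q p W =
          Gs_class (residue_ring (int p)) (P mod int p) (Q mod int p) (a mod int p) (b mod int p))) \<and>
    (short_exact (GsQ P Q\<lparr>carrier := Gs_p P Q p\<rparr>) (\<lambda>W. W)
      (GsQ P Q\<lparr>carrier := Ks_p P Q p\<rparr>) (red_Gs P Q p) (GsF P Q p))"
proof -
  interpret laxton p P Q
    using assms by unfold_locales
  show ?thesis
    by (intro conjI ballI allI impI)
      (use Ks_p_coprime_init red_Gs_coprime_init in
        \<open>simp_all add: comm_group.axioms(2)[OF laxton_group_comm_group] K.Gs.group_axioms to_GsQ_iso
          laxton_G_subgroup laxton_K_subgroup laxton_H_subgroup
          Gs_p_subgroup Ks_p_subgroup Hs_p_subgroup
          laxton_G_image laxton_K_image laxton_H_image short_exact_red_Gs\<close>)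
qed

end
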